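(* Assume the following conditions. (1) For sufficiently large $n$, $m\leqslant|\mathcal{A}_{0n}|$, and as $n\to\infty$, $m/n\to\tau\in[1/2,1-\epsilon]$. (2) For all $\theta_1,\theta_2\in\Theta$, $F_{\theta_1}=F_{\theta_2}$ implies $\theta_1=\theta_2$. (3) For all $\phi\in\Theta$, $\lim_{\theta\to\phi}d_{\mathrm K}(F_\theta,F_\phi)=0$. (4) For all $x\in\mathbb{R}^p$ and all $b\in\mathcal{C}^*(\Theta)\setminus\Theta$, $\lim_{\theta\to b}\big(F_\theta(x)-F_\theta(-x)\big)=0$. (5) For all $\theta\in\Theta$ with $\theta\neq\theta_0$, $[(1-\epsilon)F_{\theta_0}+\epsilon G-\tau F_\theta]/(1-\tau)\notin\mathcal{F}^p$. (6) For all $\mathcal{A}\in\mathfrak{D}_n$, $\hat{\theta}_{\mathcal{A}}=\arg\min_{\theta\in\Theta}d_{\mathrm K}(\hat{H}_{\mathcal{A}},F_\theta)$ exists (a.s.) for sufficiently large $n$. Let $\mathcal{A}_n^*=\arg\min_{\mathcal{A}\in\mathfrak{D}_n}\psi_n(\mathcal{A})$, where $\psi_n(\mathcal{A})=\inf_{\theta\in\Theta}d_{\mathrm K}(\hat{H}_{\mathcal{A}},F_\theta)$, and $\hat{\theta}_{\mathcal{A}_n^*}=\arg\min_{\theta\in\Theta}d_{\mathrm K}(\hat{H}_{\mathcal{A}_n^*},F_\theta)$. Then, as $n\to\infty$, (i) $\hat{\theta}_{\mathcal{A}_n^*}\to\theta_0$ almost surely; (ii) $d_{\mathrm K}(F_{\hat{\theta}_{\mathcal{A}_n^*}},F_{\theta_0})\to0$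 almost surely.
   Context: Contaminated model. $\mathbb{Z}_n=\{1,\ldots,n\}$. $\mathcal{F}^p$ is the set of all cumulative distribution functions on $\mathbb{R}^p$; $F_\theta\in\mathcal{F}^p$ for $\theta\in\Theta\subset\mathbb{R}^q$, and $G\in\mathcal{F}^p$ is the contamination distribution. $\theta_0\in\Theta$ is the true parameter and $\epsilon\in[0,1/2]$. Let $\{l_n\}$ be a nondecreasing integer sequence with $l_n/n\to1-\epsilon$, let $k_1^0<k_2^0<\cdots$ be a sequence of positive integers, and let $\mathcal{A}_{0n}=\{k_1^0,\ldots,k_{l_n}^0\}\subset\mathbb{Z}_n$ be the index set of all good observations. The observations are a sequence of random variables such that $X_1,\ldots,X_n$ are independent with $X_i\sim F_{\theta_0}$ for $i\in\mathcal{A}_{0n}$ and $X_i\sim G$ for $i\in\mathbb{Z}_n\setminus\mathcal{A}_{0n}$. $m=m_n<n$ is a pre-specified integer, $|\cdot|$ denotes cardinality, and $\mathfrak{D}_n=\{\mathcal{A}\subset\mathbb{Z}_n:|\mathcal{A}|=m\}$. $d_{\mathrm K}(F,H)=\sup_{x\in\mathbb{R}^p}|F(x)-H(x)|$ is the Kolmogorov distance, and $\hat{H}_{\mathcal{A}}$ is the empirical distribution function based on the observations $\{X_i\}_{i\in\mathcal{A}}$. $\mathcal{C}(\Theta)$ denotes the closure of $\Theta$; $\mathcal{C}^*(\Theta)=\mathcal{C}(\Theta)$ if $\Theta$ is bounded and $\mathcal{C}^*(\Theta)=\mathcal{C}(\Theta)\cup\{\infty\}$ otherwise. *)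

theory Defs
  imports "HOL-Probability.Probability"
begin

text \<open>On \<open>real ^ 'p\<close> the order is the componentwise one, so \<open>{..x}\<close> is the closed lower orthant
  with corner \<open>x\<close>. The constant \<open>cdf\<close> of the library covers the real line only.\<close>

definition mcdf :: "(real ^ 'p) measure \<Rightarrow> real ^ 'p \<Rightarrow> real" where
  "mcdf \<mu> x = measure \<mu> {..x}"

definition CDFs :: "(real ^ 'p \<Rightarrow> real) set" where
  "CDFs = {mcdf \<mu> |\<mu>. prob_space \<mu> \<and> sets \<mu> = sets borel}"

definition kolmogorov_dist :: "('a \<Rightarrow> real) \<Rightarrow> ('a \<Rightarrow> real) \<Rightarrow> real" where
  "kolmogorov_dist F H = (SUP x. \<bar>F x - H x\<bar>)"

definition empirical_cdf :: "(nat \<Rightarrow> real ^ 'p) \<Rightarrow> nat set \<Rightarrow> real ^ 'p \<Rightarrow> real" where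
  "empirical_cdf X A x = real (card {i \<in> A. X i \<le> x}) / real (card A)"

definition subsamples :: "nat \<Rightarrow> nat \<Rightarrow> nat set set" where
  "subsamples n m = {A. A \<subseteq> {1..n} \<and> card A = m}"

definition min_dist ::
  "'q set \<Rightarrow> ('q \<Rightarrow> real ^ 'p \<Rightarrow> real) \<Rightarrow> (nat \<Rightarrow> real ^ 'p) \<Rightarrow> nat set \<Rightarrow> real" where
  "min_dist \<Theta> F X A = (INF \<theta>\<in>\<Theta>. kolmogorov_dist (empirical_cdf X A) (F \<theta>))"

definition good_indices :: "(nat \<Rightarrow> nat) \<Rightarrow> (nat \<Rightarrow> nat) \<Rightarrow> nat \<Rightarrow> nat set" where
  "good_indices k l n = k ` {1..l n}"

text \<open>The closure of the parameter set, extended by a point \<open>None\<close> at infinity if the set is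
  unbounded. Finite points \<open>b\<close> are represented as \<open>Some b\<close>.\<close>

definition ext_closure :: "'q::real_normed_vector set \<Rightarrow> 'q option set" where
  "ext_closure \<Theta> = Some ` closure \<Theta> \<union> (if bounded \<Theta> then {} else {None})"

text \<open>The filter of \<open>\<theta> \<in> \<Theta>\<close> tending to a point of the extended closure; tending to infinity means
  that the norm of \<open>\<theta>\<close> tends to infinity.\<close>

definition towards :: "'q::real_normed_vector option \<Rightarrow> 'q set \<Rightarrow> 'q filter" where
  "towards b \<Theta> = (case b of Some a \<Rightarrow> at a within \<Theta> | None \<Rightarrow> inf at_infinity (principal \<Theta>))"

end

theory Submission
  imports Defs
begin

text \<open>Write \<open>\<mu> = (1 - \<epsilon>) P\<^sub>0 + \<epsilon> P\<^sub>G\<close> for the limit law of the full sample, where \<open>P\<^sub>0\<close> and \<open>P\<^sub>G\<close> have the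
  distribution functions \<open>F \<theta>0\<close> and \<open>G\<close>. The proof rests on two observations.

  The minimal distance vanishes. Some \<open>m\<close> of the good observations form a competitor for the optimal
  subsample, and by the Glivenko--Cantelli theorem their empirical distribution function converges
  uniformly to \<open>F \<theta>0\<close>. So the distance from the optimal subsample to the fitted distribution
  function, being at most that of the competitor, tends to zero almost surely.

  A subsample cannot outweigh the full sample. It contains at most the observations of the full sample
  in any given set, and its size is asymptotically the fraction \<open>\<tau>\<close> of the full size. Two consequences settle where the
  estimates can accumulate.
    \<^item> The subsample is tight because the full sample is (\<open>subsample_tight\<close>). The fitted
      distributions inherit this: for a large \<open>x\<close> they put mass at least \<open>1 / 4\<close> on \<open>{..x}\<close> outside \<open>{..-x}\<close>.
      Near a point of the extended closure outside \<open>\<Theta>\<close> this mass would tend to zero.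
    \<^item> If the estimates approach \<open>\<phi> \<in> \<Theta>\<close> along a subsequence, the law \<open>\<nu>\<close> of \<open>F \<phi>\<close> is the uniform limit
      of the subsample, and \<open>\<tau> \<nu> \<le> \<mu>\<close> (\<open>dominated_by_subsample_limit\<close>). For \<open>\<tau> < 1\<close> the measure
      \<open>(\<mu> - \<tau> \<nu>) / (1 - \<tau>)\<close> is then a probability measure, so that \<open>\<phi> = \<theta>0\<close> by the hypothesis on
      mixtures. For \<open>\<tau> = 1\<close> there is no contamination in the limit and \<open>\<nu> = P\<^sub>0\<close>, so that \<open>\<phi> = \<theta>0\<close> by
      identifiability.

  By compactness the estimates then converge to \<open>\<theta>0\<close> (\<open>minimum_distance_consistency\<close>), and continuity of
  \<open>\<theta> \<mapsto> F \<theta>\<close> in the Kolmogorov distance gives the second claim.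

  The inequality \<open>\<tau> \<nu> \<le> \<mu>\<close> is first obtained on dyadic half-open boxes, whose measures are signed sums of
  values of the distribution functions, and it extends to open sets and, by outer regularity, to all
  Borel sets (\<open>measure_le_if_dyadic_boxes\<close>). All almost sure statements come from a strong law for
  frequencies (\<open>freq_strong_law\<close>), applied to countably many sets; that countably many sets suffice
  even for uniform convergence is \<open>Glivenko_Cantelli_countable_reduction\<close>.\<close>

section \<open>Measures and their distribution functions\<close>

text \<open>The orthants form an intersection-stable generator of the Borel sets, so they determine the measure.\<close>

lemma mcdf_eqD:
  fixes \<mu> \<nu> :: "(real ^ 'p) measure"
  assumes "prob_space \<mu>" "sets \<mu> = sets borel" "prob_space \<nu>" "sets \<nu> = sets borel"
    and "mcdf \<mu> = mcdf \<nu>"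
  shows "\<mu> = \<nu>"
proof (rule measure_eqI_generator_eq)
  interpret \<mu>: prob_space \<mu> by fact
  interpret \<nu>: prob_space \<nu> by fact
  let ?E = "range (\<lambda>a. {..a :: real ^ 'p})"
  show "Int_stable ?E"
  proof (rule Int_stableI)
    fix a b assume "a \<in> ?E" "b \<in> ?E"
    then obtain x y where "a = {..x}" "b = {..y}" by auto
    then have "a \<inter> b = {..inf x y}" by auto
    then show "a \<inter> b \<in> ?E" by auto
  qed
  show "?E \<subseteq> Pow UNIV" by auto
  show "sets \<mu> = sigma_sets UNIV ?E" "sets \<nu> = sigma_sets UNIV ?E"
    by (simp_all add: assms borel_eq_atMost)
  show "emeasure \<mu> X = emeasure \<nu> X" if "X \<in> ?E" for X
    using that assms(5) by (auto simp: \<mu>.emeasure_eq_measure \<nu>.emeasure_eq_measure mcdf_def fun_eq_iff)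
  let ?A = "\<lambda>n. {..(\<chi> i. real n) :: real ^ 'p}"
  show "range ?A \<subseteq> ?E" by auto
  show "(\<Union>n. ?A n) = UNIV"
  proof (intro equalityI subsetI UNIV_I)
    fix x :: "real ^ 'p"
    obtain n where "norm x \<le> real n" using real_arch_simple by blast
    then have "x \<le> (\<chi> i. real n)"
      by (auto simp: less_eq_vec_def intro: order_trans[OF order_trans[OF abs_ge_self component_le_norm_cart]])
    then show "x \<in> (\<Union>n. ?A n)" by auto
  qed
  show "emeasure \<mu> (?A n) \<noteq> \<infinity>" for n by simp
qed

text \<open>The coefficients may be negative: nonnegativity of the combination on every set is all that a
  measure needs besides countable additivity. This covers both mixtures and renormalised differences.\<close>

lemma measure_linear_combination:
  fixes M N :: "'a measure" and a b :: real
  assumes fin: "finite_measure M" "finite_measure N" and sets: "sets N = sets M"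
    and nn: "\<And>B. B \<in> sets M \<Longrightarrow> 0 \<le> a * measure M B + b * measure N B"
  obtains L where "finite_measure L" "sets L = sets M"
    "\<And>B. B \<in> sets M \<Longrightarrow> measure L B = a * measure M B + b * measure N B"
proof -
  interpret M: finite_measure M by fact
  interpret N: finite_measure N by fact
  define f where "f = (\<lambda>B. a * measure M B + b * measure N B)"
  define L where "L = measure_of (space M) (sets M) (\<lambda>B. ennreal (f B))"
  have emeasure_L: "emeasure L B = ennreal (f B)" if "B \<in> sets M" for B
    unfolding L_def
  proof (rule emeasure_measure_of_sigma)
    show "sigma_algebra (space M) (sets M)" ..
    show "positive (sets M) (\<lambda>B. ennreal (f B))" by (simp add: positive_def f_def)
    show "countably_additive (sets M) (\<lambda>B. ennreal (f B))"
    proof (rule countably_additiveI)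
      fix A :: "nat \<Rightarrow> 'a set"
      assume A: "range A \<subseteq> sets M" "disjoint_family A" "(\<Union>i. A i) \<in> sets M"
      have "(\<lambda>i. f (A i)) sums f (\<Union>i. A i)"
        unfolding f_def
        by (intro sums_add sums_mult M.finite_measure_UNION N.finite_measure_UNION)
           (use A sets in auto)
      moreover have "0 \<le> f (A i)" for i using A nn by (auto simp: f_def)
      ultimately show "(\<Sum>i. ennreal (f (A i))) = ennreal (f (\<Union>i. A i))"
        using sums_unique[OF sums_ennreal[THEN iffD2]] A nn by (metis f_def)
    qed
  qed (use that in auto)
  have sets_L: "sets L = sets M" by (simp add: L_def)
  have space_L: "space L = space M" by (rule sets_eq_imp_space_eq[OF sets_L])
  show thesis
  proof
    show "finite_measure L" by (rule finite_measureI) (simp add: emeasure_L space_L)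
    show "sets L = sets M" by fact
    show "measure L B = a * measure M B + b * measure N B" if "B \<in> sets M" for B
      using emeasure_L[OF that] nn[OF that] by (simp add: measure_def f_def)
  qed
qed

text \<open>The law of the observations left out of the subsample, in the limit: removing the share \<open>\<tau>\<close> with law
  \<open>\<nu>\<close> from \<open>\<mu>\<close> leaves the mass \<open>1 - \<tau>\<close>.\<close>

lemma dominated_difference_in_CDFs:
  fixes \<mu> \<nu> :: "(real ^ 'p) measure"
  assumes \<mu>: "prob_space \<mu>" "sets \<mu> = sets borel" and \<nu>: "prob_space \<nu>" "sets \<nu> = sets borel"
    and "\<tau> < 1" and dom: "\<And>B. B \<in> sets borel \<Longrightarrow> \<tau> * measure \<nu> B \<le> measure \<mu> B"
  shows "(\<lambda>x. (mcdf \<mu> x - \<tau> * mcdf \<nu> x) / (1 - \<tau>)) \<in> CDFs"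
proof -
  interpret \<mu>: prob_space \<mu> by fact
  interpret \<nu>: prob_space \<nu> by fact
  let ?a = "1 / (1 - \<tau>)" and ?b = "- \<tau> / (1 - \<tau>)"
  have eq: "?a * s + ?b * t = (s - \<tau> * t) / (1 - \<tau>)" for s t by (simp add: diff_divide_distrib)
  have "0 \<le> ?a * measure \<mu> B + ?b * measure \<nu> B" if "B \<in> sets \<mu>" for B
    unfolding eq using dom[of B] that \<mu> \<open>\<tau> < 1\<close> by simp
  then obtain L where L: "finite_measure L" "sets L = sets \<mu>"
    "\<And>B. B \<in> sets \<mu> \<Longrightarrow> measure L B = ?a * measure \<mu> B + ?b * measure \<nu> B"
    using measure_linear_combination[of \<mu> \<nu> ?a ?b] \<mu> \<nu> \<mu>.finite_measure_axioms \<nu>.finite_measure_axioms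
    by (smt (verit))
  interpret L: finite_measure L by fact
  have space: "space L = space \<mu>" "space \<nu> = space \<mu>"
    using L(2) \<mu> \<nu> by (auto intro!: sets_eq_imp_space_eq)
  have "measure L (space L) = 1"
    using L(3)[OF sets.top] \<nu>.prob_space \<open>\<tau> < 1\<close> unfolding eq by (simp add: space \<mu>.prob_space)
  then have "prob_space L" by (intro prob_spaceI) (simp add: L.emeasure_eq_measure)
  moreover have "mcdf L = (\<lambda>x. (mcdf \<mu> x - \<tau> * mcdf \<nu> x) / (1 - \<tau>))"
    using L(3) \<mu> unfolding eq by (auto simp: mcdf_def)
  moreover have "sets L = sets borel" using L(2) \<mu>(2) by simp
  ultimately show ?thesis unfolding CDFs_def by (metis (mono_tags, lifting) mem_Collect_eq)
qed

text \<open>Domination applied to an orthant and to its complement gives both inequalities, as the total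
  masses agree.\<close>

lemma prob_space_dominated_mcdf_eq:
  fixes \<mu> \<nu> :: "(real ^ 'p) measure"
  assumes \<mu>: "prob_space \<mu>" "sets \<mu> = sets borel" and \<nu>: "prob_space \<nu>" "sets \<nu> = sets borel"
    and dom: "\<And>B. B \<in> sets borel \<Longrightarrow> measure \<nu> B \<le> measure \<mu> B"
  shows "mcdf \<nu> = mcdf \<mu>"
proof
  fix x
  have "measure \<nu> (space \<nu> - {..x}) \<le> measure \<mu> (space \<mu> - {..x})"
    using dom[of "- {..x}"] sets_eq_imp_space_eq[OF \<mu>(2)] sets_eq_imp_space_eq[OF \<nu>(2)]
    by (simp add: Compl_eq_Diff_UNIV)
  then have "measure \<mu> {..x} \<le> measure \<nu> {..x}"
    using prob_space.prob_compl[OF \<mu>(1), of "{..x}"] prob_space.prob_compl[OF \<nu>(1), of "{..x}"] \<mu> \<nu> by simp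
  then show "mcdf \<nu> x = mcdf \<mu> x" using dom[of "{..x}"] by (simp add: mcdf_def)
qed

section \<open>Half-open boxes and domination of measures\<close>

definition hbox :: "real ^ 'p \<Rightarrow> real ^ 'p \<Rightarrow> (real ^ 'p) set" where
  "hbox a b = {x. \<forall>i. a $ i < x $ i \<and> x $ i \<le> b $ i}"

text \<open>The vertex of the box between \<open>a\<close> and \<open>b\<close> whose coordinates in \<open>S\<close> are the lower ones.\<close>

definition corner :: "real ^ 'p \<Rightarrow> real ^ 'p \<Rightarrow> 'p set \<Rightarrow> real ^ 'p" where
  "corner a b S = (\<chi> i. if i \<in> S then a $ i else b $ i)"

text \<open>Inclusion--exclusion, as the expansion of the product over the coordinates of differences of
  indicators of half-lines. It transfers to every additive set function, here to measures and to
  empirical frequencies.\<close>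

lemma indicator_hbox:
  fixes a b :: "real ^ 'p"
  assumes ab: "a \<le> b"
  shows "indicator (hbox a b) x = (\<Sum>S\<in>UNIV. (-1) ^ card S * indicator {..corner a b S} x :: real)"
proof -
  let ?f = "\<lambda>t i. of_bool (x $ i \<le> t $ i) :: real"
  have prod_of_bool: "(\<Prod>i\<in>S. of_bool (P i)) = (of_bool (\<forall>i\<in>S. P i) :: real)"
    for S :: "'p set" and P
    by (induction S rule: infinite_finite_induct) auto
  have "indicator (hbox a b) x = (\<Prod>i\<in>UNIV. ?f b i - ?f a i)"
  proof -
    have "?f b i - ?f a i = of_bool (a $ i < x $ i \<and> x $ i \<le> b $ i)" for i
      using ab by (auto simp: less_eq_vec_def) (meson order_trans)
    then show ?thesis by (simp add: prod_of_bool hbox_def indicator_def)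
  qed
  also have "\<dots> = (\<Sum>S\<in>Pow UNIV. (-1) ^ card S * (\<Prod>i\<in>S. ?f a i) * (\<Prod>i\<in>UNIV - S. ?f b i))"
    by (rule prod_diff_conv_sum) simp
  also have "\<dots> = (\<Sum>S\<in>UNIV. (-1) ^ card S * indicator {..corner a b S} x)"
    by (intro sum.cong)
       (auto simp: prod_of_bool corner_def indicator_def less_eq_vec_def)
  finally show ?thesis .
qed

lemma hbox_borel [measurable]: "hbox a b \<in> sets borel"
proof -
  have "hbox a b = (\<Inter>i. {x. a $ i < x $ i} \<inter> {x. x $ i \<le> b $ i})" by (auto simp: hbox_def)
  also have "\<dots> \<in> sets borel"
    by (intro sets.countable_INT'' sets.Int borel_open borel_closed
        open_halfspace_component_gt_cart closed_halfspace_component_le_cart) auto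
  finally show ?thesis .
qed

lemma measure_hbox:
  fixes \<mu> :: "(real ^ 'p) measure"
  assumes "finite_measure \<mu>" and sets: "sets \<mu> = sets borel" and ab: "a \<le> b"
  shows "measure \<mu> (hbox a b) = (\<Sum>S\<in>UNIV. (-1) ^ card S * mcdf \<mu> (corner a b S))"
proof -
  interpret finite_measure \<mu> by fact
  have "measure \<mu> (hbox a b) = (\<integral>x. indicator (hbox a b) x \<partial>\<mu>)"
    by (simp add: sets)
  also have "\<dots> = (\<integral>x. (\<Sum>S\<in>UNIV. (-1) ^ card S * indicator {..corner a b S} x) \<partial>\<mu>)"
    by (simp add: indicator_hbox[OF ab])
  also have "\<dots> = (\<Sum>S\<in>UNIV. (-1) ^ card S * mcdf \<mu> (corner a b S))"
    by (subst Bochner_Integration.integral_sum)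
       (auto simp: sets mcdf_def less_top[symmetric] intro!: integrable_mult_right integrable_real_indicator)
  finally show ?thesis .
qed

definition dyadic_point :: "nat \<Rightarrow> int ^ 'p \<Rightarrow> real ^ 'p" where
  "dyadic_point k z = (\<chi> i. of_int (z $ i) / 2 ^ k)"

text \<open>The index \<open>z\<close> belongs to the upper corner because the boxes are closed above. The boxes of one level
  then partition the space according to the values of \<open>\<lceil>2 ^ k * x $ i\<rceil>\<close>.\<close>

definition dyadic_box :: "nat \<Rightarrow> int ^ 'p \<Rightarrow> (real ^ 'p) set" where
  "dyadic_box k z = hbox (dyadic_point k (z - 1)) (dyadic_point k z)"

lemma mem_dyadic_box: "x \<in> dyadic_box k z \<longleftrightarrow> z = (\<chi> i. \<lceil>2 ^ k * x $ i\<rceil>)"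
proof -
  have "x \<in> dyadic_box k z \<longleftrightarrow> (\<forall>i. of_int (z $ i) - 1 < 2 ^ k * x $ i \<and> 2 ^ k * x $ i \<le> of_int (z $ i))"
    by (simp add: dyadic_box_def hbox_def dyadic_point_def field_simps)
  also have "\<dots> \<longleftrightarrow> (\<forall>i. \<lceil>2 ^ k * x $ i\<rceil> = z $ i)" by (simp add: ceiling_eq_iff)
  finally show ?thesis by (auto simp: vec_eq_iff)
qed

text \<open>The boxes are nested over the levels, so that a point of \<open>V k\<close> stays in \<open>V (Suc k)\<close>, and
  their diameters tend to zero, so that every point of an open set is reached.\<close>

lemma open_eq_Union_dyadic_boxes:
  fixes U :: "(real ^ 'p) set"
  assumes "open U"
  defines "V \<equiv> \<lambda>k. \<Union> (dyadic_box k ` {z. dyadic_box k z \<subseteq> U})"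
  shows "incseq V" "(\<Union>k. V k) = U"
proof -
  define z where "z = (\<lambda>k (x :: real ^ 'p). (\<chi> i. \<lceil>2 ^ k * x $ i\<rceil>))"
  have V: "x \<in> V k \<longleftrightarrow> dyadic_box k (z k x) \<subseteq> U" for x k
    by (auto simp: V_def mem_dyadic_box z_def)
  show "incseq V"
  proof (rule incseq_SucI, rule subsetI)
    fix k x assume "x \<in> V k"
    have "y \<in> dyadic_box k (z k x)" if "y \<in> dyadic_box (Suc k) (z (Suc k) x)" for y
    proof -
      \<comment> \<open>The ceiling at a finer level determines the one at the coarser level.\<close>
      have half: "\<lceil>s\<rceil> = \<lceil>t\<rceil>" if "\<lceil>2 * s\<rceil> = \<lceil>2 * t\<rceil>" for s t :: real
      proof -
        have "\<lceil>u\<rceil> \<le> a \<longleftrightarrow> \<lceil>2 * u\<rceil> \<le> 2 * a" for u :: real and a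
          by (simp add: ceiling_le_iff)
        then show ?thesis using that by (metis order_antisym order_refl)
      qed
      have "\<lceil>2 * (2 ^ k * y $ i)\<rceil> = \<lceil>2 * (2 ^ k * x $ i)\<rceil>" for i
        using that by (simp add: mem_dyadic_box z_def vec_eq_iff mult.assoc)
      then have "\<lceil>2 ^ k * y $ i\<rceil> = \<lceil>2 ^ k * x $ i\<rceil>" for i by (rule half)
      then show ?thesis by (simp add: mem_dyadic_box z_def)
    qed
    then show "x \<in> V (Suc k)" using \<open>x \<in> V k\<close> by (auto simp: V)
  qed
  have "x \<in> (\<Union>k. V k)" if "x \<in> U" for x
  proof -
    obtain e where e: "e > 0" "ball x e \<subseteq> U" using \<open>open U\<close> \<open>x \<in> U\<close> openE by blast
    define d where "d = e / real CARD('p)"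
    have "d > 0" using e by (simp add: d_def)
    then obtain k where k: "(1 / 2) ^ k < d" using real_arch_pow_inv[of d "1/2"] by auto
    have "y \<in> ball x e" if "y \<in> dyadic_box k (z k x)" for y
    proof -
      have ceil_close: "\<bar>s - t\<bar> < 1" if "\<lceil>s\<rceil> = \<lceil>t\<rceil>" for s t :: real
        using that by linarith
      have "\<bar>(x - y) $ i\<bar> < d" for i
      proof -
        have "\<lceil>2 ^ k * x $ i\<rceil> = \<lceil>2 ^ k * y $ i\<rceil>"
          using that by (simp add: mem_dyadic_box z_def vec_eq_iff)
        then have "\<bar>2 ^ k * x $ i - 2 ^ k * y $ i\<bar> < 1" by (rule ceil_close)
        then have "2 ^ k * \<bar>(x - y) $ i\<bar> < 1"
          by (simp add: abs_mult flip: right_diff_distrib)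
        then have "\<bar>(x - y) $ i\<bar> < (1 / 2) ^ k" by (simp add: field_simps)
        then show ?thesis using k by simp
      qed
      then have "(\<Sum>i\<in>UNIV. \<bar>(x - y) $ i\<bar>) < (\<Sum>i\<in>(UNIV :: 'p set). d)"
        by (intro sum_strict_mono) auto
      then have "norm (x - y) < e"
        using norm_le_l1_cart[of "x - y"] by (simp add: d_def)
      then show ?thesis by (simp add: dist_norm)
    qed
    then have "dyadic_box k (z k x) \<subseteq> U" using e by blast
    then show ?thesis by (auto simp: V)
  qed
  then show "(\<Union>k. V k) = U" by (auto simp: V_def)
qed

text \<open>At each level an open set is approximated from inside by a countable disjoint union of boxes, where
  the inequality adds up; the limit over the levels gives the open set itself. Outer regularity of \<open>\<mu>\<close>
  then replaces a Borel set by an open superset of almost the same measure.\<close>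

lemma measure_le_if_dyadic_boxes:
  fixes \<mu> \<nu> :: "(real ^ 'p) measure"
  assumes fin: "finite_measure \<mu>" "finite_measure \<nu>"
    and sets: "sets \<mu> = sets borel" "sets \<nu> = sets borel" and c: "0 \<le> c"
    and le: "\<And>k z. c * measure \<nu> (dyadic_box k z) \<le> measure \<mu> (dyadic_box k z)"
    and B: "B \<in> sets borel"
  shows "c * measure \<nu> B \<le> measure \<mu> B"
proof -
  interpret \<mu>: finite_measure \<mu> by fact
  interpret \<nu>: finite_measure \<nu> by fact
  have open_le: "c * measure \<nu> U \<le> measure \<mu> U" if "open U" for U
  proof -
    define V where "V = (\<lambda>k. \<Union> (dyadic_box k ` {z. dyadic_box k z \<subseteq> U}))"
    have meas: "dyadic_box k z \<in> sets borel" for k and z :: "int ^ 'p" by (simp add: dyadic_box_def)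
    have V_meas: "V k \<in> sets borel" for k unfolding V_def
      by (intro sets.countable_UN') (auto simp: meas)
    have "c * measure \<nu> (V k) \<le> measure \<mu> (V k)" for k
    proof -
      let ?Z = "{z. dyadic_box k z \<subseteq> U}"
      have cnt: "countable ?Z" by (rule countableI_type)
      have disj: "disjoint_family_on (dyadic_box k) ?Z"
        by (auto simp: disjoint_family_on_def mem_dyadic_box)
      have \<nu>: "emeasure \<nu> (V k) = (\<integral>\<^sup>+z. emeasure \<nu> (dyadic_box k z) \<partial>count_space ?Z)"
        unfolding V_def by (intro emeasure_UN_countable) (auto simp: sets meas cnt disj)
      have \<mu>: "emeasure \<mu> (V k) = (\<integral>\<^sup>+z. emeasure \<mu> (dyadic_box k z) \<partial>count_space ?Z)"
        unfolding V_def by (intro emeasure_UN_countable) (auto simp: sets meas cnt disj)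
      have "ennreal c * emeasure \<nu> (V k) \<le> emeasure \<mu> (V k)"
        unfolding \<mu> \<nu>
        by (subst nn_integral_cmult[symmetric], simp, intro nn_integral_mono)
           (use le c in \<open>simp add: \<mu>.emeasure_eq_measure \<nu>.emeasure_eq_measure
              ennreal_mult[symmetric] ennreal_leI\<close>)
      then show ?thesis
        using c by (simp add: \<mu>.emeasure_eq_measure \<nu>.emeasure_eq_measure ennreal_mult[symmetric])
    qed
    moreover have "(\<lambda>k. measure \<nu> (V k)) \<longlonglongrightarrow> measure \<nu> U" "(\<lambda>k. measure \<mu> (V k)) \<longlonglongrightarrow> measure \<mu> U"
      using \<mu>.finite_Lim_measure_incseq[of V] \<nu>.finite_Lim_measure_incseq[of V]
        open_eq_Union_dyadic_boxes[OF that] V_meas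
      by (auto simp: V_def sets)
    ultimately show ?thesis
      by (intro LIMSEQ_le[OF tendsto_mult_left]) auto
  qed
  show ?thesis
  proof (rule field_le_epsilon)
    fix e :: real assume "e > 0"
    have "emeasure \<mu> B < emeasure \<mu> B + ennreal e"
      using \<open>e > 0\<close>
      by (simp add: \<mu>.emeasure_eq_measure ennreal_plus[symmetric] ennreal_less_iff del: ennreal_plus)
    then have "(INF U \<in> {U. B \<subseteq> U \<and> open U}. emeasure \<mu> U) < emeasure \<mu> B + ennreal e"
      using outer_regular[of \<mu> B] sets B by simp
    then obtain U where U: "B \<subseteq> U" "open U" "emeasure \<mu> U < emeasure \<mu> B + ennreal e"
      by (auto simp: Inf_less_iff)
    then have "measure \<mu> U < measure \<mu> B + e"
      using \<open>e > 0\<close>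
      by (simp add: \<mu>.emeasure_eq_measure ennreal_plus[symmetric] ennreal_less_iff del: ennreal_plus)
    moreover have "c * measure \<nu> B \<le> c * measure \<nu> U"
      using c U B by (intro mult_left_mono \<nu>.finite_measure_mono) (auto simp: sets)
    ultimately show "c * measure \<nu> B \<le> measure \<mu> B + e" using open_le[OF U(2)] by linarith
  qed
qed

section \<open>Empirical frequencies and the Kolmogorov distance\<close>

definition freq :: "(nat \<Rightarrow> 'a) \<Rightarrow> nat set \<Rightarrow> 'a set \<Rightarrow> real" where
  "freq X A B = real (card {i \<in> A. X i \<in> B}) / real (card A)"

lemma empirical_cdf_eq_freq: "empirical_cdf X A x = freq X A {..x}"
  by (simp add: empirical_cdf_def freq_def)

lemma freq_mono: "finite A \<Longrightarrow> B \<subseteq> C \<Longrightarrow> freq X A B \<le> freq X A C"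
  unfolding freq_def by (intro divide_right_mono of_nat_mono card_mono) auto

lemma freq_nonneg: "0 \<le> freq X A B"
  by (simp add: freq_def)

lemma freq_le_1: "freq X A B \<le> 1"
proof (cases "finite A")
  case True
  then have "card {i \<in> A. X i \<in> B} \<le> card A" by (intro card_mono) auto
  then show ?thesis by (simp add: freq_def divide_le_eq)
qed (simp add: freq_def)

lemma kolmogorov_dist_le:
  assumes "\<And>x. \<bar>F x - H x\<bar> \<le> d"
  shows "kolmogorov_dist F H \<le> d"
  unfolding kolmogorov_dist_def by (rule cSUP_least) (use assms in auto)

lemma kolmogorov_dist_upper:
  assumes "\<And>x. 0 \<le> F x" "\<And>x. F x \<le> 1" "\<And>x. 0 \<le> H x" "\<And>x. H x \<le> 1"
  shows "\<bar>F x - H x\<bar> \<le> kolmogorov_dist F H"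
  unfolding kolmogorov_dist_def
proof (rule cSUP_upper)
  have "\<bar>F y - H y\<bar> \<le> 1" for y using assms[of y] by linarith
  then show "bdd_above (range (\<lambda>x. \<bar>F x - H x\<bar>))" by (intro bdd_aboveI[of _ 1]) auto
qed simp

lemma CDFs_bounds:
  assumes "F \<in> CDFs" shows "0 \<le> F x" "F x \<le> 1"
  using assms by (auto simp: CDFs_def mcdf_def prob_space.prob_le_1)

lemma kolmogorov_dist_empirical_upper:
  assumes "F \<in> CDFs"
  shows "\<bar>empirical_cdf X A x - F x\<bar> \<le> kolmogorov_dist (empirical_cdf X A) F"
  by (intro kolmogorov_dist_upper) (simp_all add: empirical_cdf_eq_freq freq_nonneg freq_le_1 CDFs_bounds[OF assms])

lemma kolmogorov_dist_self [simp]: "kolmogorov_dist F F = 0"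
  by (simp add: kolmogorov_dist_def)

lemma kolmogorov_dist_nonneg:
  assumes "\<And>x. 0 \<le> F x" "\<And>x. F x \<le> 1" "\<And>x. 0 \<le> H x" "\<And>x. H x \<le> 1"
  shows "0 \<le> kolmogorov_dist F H"
  using order_trans[OF abs_ge_zero kolmogorov_dist_upper[OF assms]] .

lemma kolmogorov_dist_triangle:
  assumes "\<And>x. 0 \<le> F x" "\<And>x. F x \<le> 1" "\<And>x. 0 \<le> G x" "\<And>x. G x \<le> 1" "\<And>x. 0 \<le> H x" "\<And>x. H x \<le> 1"
  shows "kolmogorov_dist F H \<le> kolmogorov_dist F G + kolmogorov_dist G H"
proof (rule kolmogorov_dist_le)
  fix x
  have "\<bar>F x - G x\<bar> \<le> kolmogorov_dist F G" by (intro kolmogorov_dist_upper assms)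
  moreover have "\<bar>G x - H x\<bar> \<le> kolmogorov_dist G H" by (intro kolmogorov_dist_upper assms)
  ultimately show "\<bar>F x - H x\<bar> \<le> kolmogorov_dist F G + kolmogorov_dist G H" by linarith
qed

lemma empirical_cdf_bounds: "0 \<le> empirical_cdf X A x" "empirical_cdf X A x \<le> 1"
  by (simp_all add: empirical_cdf_eq_freq freq_nonneg freq_le_1)

section \<open>Reduction of uniform convergence to countably many sets\<close>

text \<open>With \<open>q\<close> the \<open>c\<close>-quantile of \<open>N\<close>, the sets are \<open>V = {..<q}\<close> and \<open>W = {..q}\<close>: an atom at \<open>q\<close> is
  excluded from \<open>V\<close> and included in \<open>W\<close>. The guards on \<open>c\<close> cover the values without a finite
  quantile, where both sets degenerate to \<open>{}\<close> or \<open>UNIV\<close>.\<close>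

lemma quantile_halflines:
  assumes "prob_space N" and sets: "sets N = sets borel"
  obtains V W :: "real set" where "V \<in> sets borel" "W \<in> sets borel"
    "0 \<le> c \<Longrightarrow> measure N V \<le> c" "c \<le> 1 \<Longrightarrow> c \<le> measure N W"
    "\<And>t. cdf N t < c \<Longrightarrow> {..t} \<subseteq> V" "\<And>t. c \<le> cdf N t \<Longrightarrow> W \<subseteq> {..t}"
proof -
  interpret prob_space N by fact
  interpret finite_borel_measure N using sets by unfold_locales
  define S where "S = {t. c \<le> cdf N t}"
  have space: "space N = UNIV" using sets_eq_imp_space_eq[OF sets] by simp
  consider "c \<le> 0" | "c > 0" "S = {}" | "c > 0" "S \<noteq> {}" by linarith
  then show thesis
  proof cases
    case 1
    then have "\<not> cdf N t < c" for t using cdf_nonneg[of t] by linarith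
    then show thesis using 1 by (intro that[of "{}" "{}"]) auto
  next
    case 2
    then have lt: "cdf N t < c" for t by (auto simp: S_def not_le)
    have "1 \<le> c"
      using LIMSEQ_le_const2[OF cdf_lim_infty] lt
      by (metis less_imp_le prob_space)
    then show thesis
      using prob_space space lt by (intro that[of UNIV UNIV]) (auto simp: not_le[symmetric])
  next
    case 3
    have "eventually (\<lambda>t. cdf N t < c) at_bot"
      using cdf_lim_at_bot 3 by (auto intro: order_tendstoD)
    then obtain a where a: "\<And>t. t \<le> a \<Longrightarrow> cdf N t < c" by (auto simp: eventually_at_bot_linorder)
    have bdd: "bdd_below S"
    proof (rule bdd_belowI[of _ a])
      show "a \<le> s" if "s \<in> S" for s using that a[of s] by (cases "s \<le> a") (auto simp: S_def)
    qed
    let ?q = "Inf S"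
    have up: "c \<le> cdf N t" if t: "?q < t" for t
    proof -
      obtain s where "s \<in> S" "s < t" using t cInf_less_iff[OF 3(2) bdd, of t] by blast
      then show ?thesis using cdf_nondecreasing[of s t] by (auto simp: S_def)
    qed
    have low: "cdf N t < c" if "t < ?q" for t
      using cInf_lower[OF _ bdd, of t] that by (force simp: S_def not_le[symmetric])
    have "c \<le> cdf N ?q"
    proof (rule tendsto_lowerbound)
      show "(cdf N \<longlongrightarrow> cdf N ?q) (at_right ?q)"
        using cdf_is_right_cont by (simp add: continuous_within)
      show "\<forall>\<^sub>F t in at_right ?q. c \<le> cdf N t"
        using up by (auto simp: eventually_at_right_field intro: exI[of _ "?q + 1"])
    qed simp
    moreover have "measure N {..<?q} \<le> c"
    proof (rule tendsto_upperbound[OF cdf_at_left])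
      show "\<forall>\<^sub>F t in at_left ?q. cdf N t \<le> c"
        using low by (auto simp: eventually_at_left_field less_imp_le intro: exI[of _ "?q - 1"])
    qed simp
    moreover have "t < ?q" if "cdf N t < c" for t
      using that up[of t] \<open>c \<le> cdf N ?q\<close> by (cases t ?q rule: linorder_cases) auto
    moreover have "?q \<le> t" if "c \<le> cdf N t" for t
      using cInf_lower[OF _ bdd, of t] that by (auto simp: S_def)
    ultimately show thesis
      by (intro that[of "{..<?q}" "{..?q}"]) (fastforce simp: cdf_def)+
  qed
qed

text \<open>A finite bracketing, in the sense of empirical process theory, of the family of lower orthants.
  On the real line the orthants are the half-lines \<open>{..x}\<close>.\<close>

definition orthant_brackets ::
  "'a::{ord, topological_space} measure \<Rightarrow> real \<Rightarrow> ('a set \<times> 'a set) set \<Rightarrow> bool" where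
  "orthant_brackets \<mu> d K \<longleftrightarrow> finite K \<and> (\<forall>(L, U)\<in>K. L \<in> sets borel \<and> U \<in> sets borel) \<and>
     (\<forall>x. \<exists>(L, U)\<in>K. L \<subseteq> {..x} \<and> {..x} \<subseteq> U \<and> measure \<mu> (U - L) \<le> d)"

text \<open>Half-lines whose probabilities lie in the same interval \<open>[j d, (j + 1) d)\<close> share a bracket
  given by the quantiles of the two endpoints; there are finitely many such intervals in \<open>[0, 1]\<close>.\<close>

lemma orthant_brackets_real:
  assumes "prob_space N" and sets: "sets N = sets borel" and d: "0 < d"
  obtains K :: "(real set \<times> real set) set" where "orthant_brackets N d K"
proof -
  interpret prob_space N by fact
  interpret finite_borel_measure N using sets by unfold_locales
  have "\<exists>V W. V \<in> sets borel \<and> W \<in> sets borel \<and> (0 \<le> c \<longrightarrow> measure N V \<le> c) \<and> (c \<le> 1 \<longrightarrow> c \<le> measure N W)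
     \<and> (\<forall>t. cdf N t < c \<longrightarrow> {..t} \<subseteq> V) \<and> (\<forall>t. c \<le> cdf N t \<longrightarrow> W \<subseteq> {..t})" for c
    by (rule quantile_halflines[OF assms(1,2), of c]) blast
  then obtain V W where VW: "\<And>c. V c \<in> sets borel" "\<And>c. W c \<in> sets borel"
    "\<And>c. 0 \<le> c \<Longrightarrow> measure N (V c) \<le> c" "\<And>c. c \<le> 1 \<Longrightarrow> c \<le> measure N (W c)"
    "\<And>c t. cdf N t < c \<Longrightarrow> {..t} \<subseteq> V c" "\<And>c t. c \<le> cdf N t \<Longrightarrow> W c \<subseteq> {..t}"
    by metis
  define K where "K = (\<lambda>j. (W (of_int j * d), V (of_int (j + 1) * d))) ` {0..\<lfloor>1 / d\<rfloor>}"
  have "orthant_brackets N d K"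
    unfolding orthant_brackets_def
  proof (intro conjI allI)
    show "finite K" by (simp add: K_def)
    show "\<forall>(L, U)\<in>K. L \<in> sets borel \<and> U \<in> sets borel"
      using VW by (auto simp: K_def)
    fix t
    define j where "j = \<lfloor>cdf N t / d\<rfloor>"
    have F: "0 \<le> cdf N t" "cdf N t \<le> 1"
      using cdf_nonneg cdf_bounded[of t] by (simp_all add: prob_space)
    have j: "of_int j * d \<le> cdf N t" "cdf N t < of_int (j + 1) * d"
      using d by (simp_all add: j_def flip: pos_le_divide_eq pos_divide_less_eq)
    have "0 \<le> j" "j \<le> \<lfloor>1 / d\<rfloor>"
      using F d by (auto simp: j_def intro!: floor_mono divide_right_mono)
    have sub: "W (of_int j * d) \<subseteq> {..t}" "{..t} \<subseteq> V (of_int (j + 1) * d)"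
      using VW j by blast+
    have "measure N (V (of_int (j + 1) * d) - W (of_int j * d))
        = measure N (V (of_int (j + 1) * d)) - measure N (W (of_int j * d))"
      using sub VW by (intro finite_measure_Diff) auto
    also have "\<dots> \<le> of_int (j + 1) * d - of_int j * d"
      using VW(3)[of "of_int (j + 1) * d"] VW(4)[of "of_int j * d"] F j d \<open>0 \<le> j\<close>
      by (smt (verit) mult_nonneg_nonneg of_int_0_le_iff)
    also have "\<dots> = d" by (simp add: algebra_simps)
    finally show "\<exists>(L, U)\<in>K. L \<subseteq> {..t} \<and> {..t} \<subseteq> U \<and> measure N (U - L) \<le> d"
      using sub \<open>0 \<le> j\<close> \<open>j \<le> \<lfloor>1 / d\<rfloor>\<close>
      by (intro bexI[of _ "(W (of_int j * d), V (of_int (j + 1) * d))"]) (auto simp: K_def)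
  qed
  then show thesis by (rule that)
qed

text \<open>Products of brackets for the coordinates. The difference of the two products is covered by the
  differences in the single coordinates, so marginal brackets of size \<open>d\<close> over the dimension suffice.\<close>

lemma orthant_brackets_vec:
  fixes \<mu> :: "(real ^ 'p) measure"
  assumes "prob_space \<mu>" and sets: "sets \<mu> = sets borel" and d: "0 < d"
  obtains K where "orthant_brackets \<mu> d K"
proof -
  interpret prob_space \<mu> by fact
  have space: "space \<mu> = UNIV" using sets_eq_imp_space_eq[OF sets] by simp
  have coord [measurable]: "(\<lambda>x. x $ i) \<in> borel_measurable \<mu>" for i
    by (subst measurable_cong_sets[OF sets refl]) simp
  define N where "N = (\<lambda>i. distr \<mu> borel (\<lambda>x. x $ i))"
  define e where "e = d / real CARD('p)"
  have "e > 0" using d by (simp add: e_def)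
  have "\<exists>K. orthant_brackets (N i) e K" for i
  proof -
    have "prob_space (N i)" unfolding N_def by (rule prob_space_distr[OF coord])
    moreover have "sets (N i) = sets borel" by (simp add: N_def)
    ultimately show ?thesis using \<open>e > 0\<close> by (rule orthant_brackets_real) blast
  qed
  then obtain K where K: "\<And>i. orthant_brackets (N i) e (K i)" by metis
  define cyl where "cyl = (\<lambda>C :: 'p \<Rightarrow> real set. {x :: real ^ 'p. \<forall>i. x $ i \<in> C i})"
  define J where "J = (\<lambda>f. (cyl (\<lambda>i. fst (f i)), cyl (\<lambda>i. snd (f i)))) ` (PiE UNIV K)"
  have cyl_meas: "cyl C \<in> sets borel" if "\<And>i. C i \<in> sets borel" for C
  proof -
    have "(\<lambda>x. x $ i) \<in> borel_measurable (borel :: (real ^ 'p) measure)" for i by simp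
    then have "(\<Inter>i. (\<lambda>x. x $ i) -` C i \<inter> space borel) \<in> sets (borel :: (real ^ 'p) measure)"
      by (intro sets.countable_INT'' measurable_sets[OF _ that]) auto
    also have "(\<Inter>i. (\<lambda>x. x $ i) -` C i \<inter> space borel) = cyl C" by (auto simp: cyl_def)
    finally show ?thesis .
  qed
  have K_meas: "fst (f i) \<in> sets borel" "snd (f i) \<in> sets borel" if "f \<in> PiE UNIV K" for f i
    using that K[of i] by (auto simp: PiE_iff orthant_brackets_def split_beta)
  have "orthant_brackets \<mu> d J"
    unfolding orthant_brackets_def
  proof (intro conjI allI)
    show "finite J" unfolding J_def using K
      by (intro finite_imageI finite_PiE) (auto simp: orthant_brackets_def)
    show "\<forall>(L, U)\<in>J. L \<in> sets borel \<and> U \<in> sets borel"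
      using K_meas by (auto simp: J_def intro!: cyl_meas)
    fix x
    have "\<forall>i. \<exists>p. p \<in> K i \<and> fst p \<subseteq> {..x $ i} \<and> {..x $ i} \<subseteq> snd p \<and> measure (N i) (snd p - fst p) \<le> e"
      using K unfolding orthant_brackets_def split_beta by blast
    then obtain f where f: "\<And>i. f i \<in> K i" "\<And>i. fst (f i) \<subseteq> {..x $ i}" "\<And>i. {..x $ i} \<subseteq> snd (f i)"
      "\<And>i. measure (N i) (snd (f i) - fst (f i)) \<le> e" by metis
    let ?L = "cyl (\<lambda>i. fst (f i))" and ?U = "cyl (\<lambda>i. snd (f i))"
    have fK: "f \<in> PiE UNIV K" using f by auto
    let ?D = "\<lambda>i. (\<lambda>x. x $ i) -` (snd (f i) - fst (f i)) \<inter> space \<mu>"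
    have "measure \<mu> (?U - ?L) \<le> measure \<mu> (\<Union>i. ?D i)"
      using K_meas[OF fK]
      by (intro finite_measure_mono sets.finite_UN measurable_sets[OF coord]) (auto simp: cyl_def space)
    also have "\<dots> \<le> (\<Sum>i\<in>UNIV. measure \<mu> (?D i))"
      using K_meas[OF fK]
      by (intro finite_measure_subadditive_finite) (auto intro!: measurable_sets[OF coord])
    also have "\<dots> \<le> (\<Sum>i\<in>(UNIV :: 'p set). e)"
      using f(4) K_meas[OF fK] by (intro sum_mono) (simp add: N_def measure_distr)
    also have "\<dots> = d" by (simp add: e_def)
    finally have "measure \<mu> (?U - ?L) \<le> d" .
    moreover have "?L \<subseteq> {..x}" "{..x} \<subseteq> ?U"
      using f(2,3) by (force simp: cyl_def less_eq_vec_def)+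
    ultimately show "\<exists>(L, U)\<in>J. L \<subseteq> {..x} \<and> {..x} \<subseteq> U \<and> measure \<mu> (U - L) \<le> d"
      using fK by (auto simp: J_def)
  qed
  then show thesis by (rule that)
qed

text \<open>The deterministic part of the Glivenko--Cantelli theorem: \<open>\<B>\<close> collects the endpoints of finite
  bracketings for the sizes \<open>1 / Suc k\<close>, and an orthant deviates by at most the size of its bracket plus the
  deviation at the endpoints. The family depends on \<open>\<mu>\<close> only, so that the almost sure exceptional sets
  can be combined.\<close>

lemma Glivenko_Cantelli_countable_reduction:
  fixes \<mu> :: "(real ^ 'p) measure"
  assumes "prob_space \<mu>" and sets: "sets \<mu> = sets borel"
  obtains \<B> :: "(real ^ 'p) set set" where "countable \<B>" "\<B> \<subseteq> sets borel"
    "\<And>X A. (\<And>n. finite (A n)) \<Longrightarrow> (\<And>B. B \<in> \<B> \<Longrightarrow> (\<lambda>n. freq X (A n) B) \<longlonglongrightarrow> measure \<mu> B) \<Longrightarrow>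
       (\<lambda>n. kolmogorov_dist (empirical_cdf X (A n)) (mcdf \<mu>)) \<longlonglongrightarrow> 0"
proof -
  interpret prob_space \<mu> by fact
  have "\<exists>K. orthant_brackets \<mu> (1 / real (Suc k)) K" for k
    by (rule orthant_brackets_vec[OF assms, of "1 / real (Suc k)"]) auto
  then obtain K where "\<And>k. orthant_brackets \<mu> (1 / real (Suc k)) (K k)" by metis
  then have K: "\<And>k. finite (K k)" "\<And>k. \<forall>(L, U)\<in>K k. L \<in> sets borel \<and> U \<in> sets borel"
    "\<And>k x. \<exists>(L, U)\<in>K k. L \<subseteq> {..x} \<and> {..x} \<subseteq> U \<and> measure \<mu> (U - L) \<le> 1 / real (Suc k)"
    by (simp_all add: orthant_brackets_def)
  define \<B> where "\<B> = (\<Union>k. fst ` K k \<union> snd ` K k)"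
  show thesis
  proof (rule that[of \<B>])
    show "countable \<B>"
      unfolding \<B>_def using K(1) by (intro countable_UN) (auto intro: countable_finite)
    show "\<B> \<subseteq> sets borel" using K(2) by (force simp: \<B>_def)
    fix X :: "nat \<Rightarrow> real ^ 'p" and A :: "nat \<Rightarrow> nat set"
    assume fin: "\<And>n. finite (A n)"
      and lim: "\<And>B. B \<in> \<B> \<Longrightarrow> (\<lambda>n. freq X (A n) B) \<longlonglongrightarrow> measure \<mu> B"
    show "(\<lambda>n. kolmogorov_dist (empirical_cdf X (A n)) (mcdf \<mu>)) \<longlonglongrightarrow> 0"
    proof (rule LIMSEQ_I)
      fix r :: real assume "r > 0"
      then obtain k where k: "1 / real (Suc k) < r / 2" using nat_approx_posE[of "r / 2"] by auto
      define S where "S = fst ` K k \<union> snd ` K k"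
      have "eventually (\<lambda>n. dist (freq X (A n) B) (measure \<mu> B) < r / 4) sequentially" if "B \<in> S" for B
        by (rule tendstoD[OF lim]) (use that \<open>r > 0\<close> in \<open>auto simp: \<B>_def S_def\<close>)
      then have "eventually (\<lambda>n. \<forall>B\<in>S. dist (freq X (A n) B) (measure \<mu> B) < r / 4) sequentially"
        using K(1) by (intro eventually_ball_finite) (auto simp: S_def)
      then have "eventually (\<lambda>n. kolmogorov_dist (empirical_cdf X (A n)) (mcdf \<mu>) \<le> 3 * r / 4) sequentially"
      proof eventually_elim
        fix n assume close: "\<forall>B\<in>S. dist (freq X (A n) B) (measure \<mu> B) < r / 4"
        show "kolmogorov_dist (empirical_cdf X (A n)) (mcdf \<mu>) \<le> 3 * r / 4"
        proof (rule kolmogorov_dist_le)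
          fix x
          obtain L U where LU: "(L, U) \<in> K k" "L \<subseteq> {..x}" "{..x} \<subseteq> U" "measure \<mu> (U - L) \<le> 1 / real (Suc k)"
            using K(3) by blast
          have meas: "L \<in> sets \<mu>" "U \<in> sets \<mu>" "{..x} \<in> sets \<mu>" using K(2) LU(1) sets by auto
          have "L \<in> S" "U \<in> S" using LU(1) by (force simp: S_def)+
          then have d: "\<bar>freq X (A n) L - measure \<mu> L\<bar> < r / 4" "\<bar>freq X (A n) U - measure \<mu> U\<bar> < r / 4"
            using close by (auto simp: dist_real_def)
          have "measure \<mu> U - measure \<mu> L = measure \<mu> (U - L)"
            using LU meas by (subst finite_measure_Diff) auto
          moreover have "measure \<mu> L \<le> measure \<mu> {..x}" "measure \<mu> {..x} \<le> measure \<mu> U"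
            using LU meas by (auto intro!: finite_measure_mono)
          moreover have "freq X (A n) L \<le> freq X (A n) {..x}" "freq X (A n) {..x} \<le> freq X (A n) U"
            using LU fin by (auto intro!: freq_mono)
          ultimately show "\<bar>empirical_cdf X (A n) x - mcdf \<mu> x\<bar> \<le> 3 * r / 4"
            unfolding empirical_cdf_eq_freq mcdf_def using d LU(4) k by linarith
        qed
      qed
      moreover have "0 \<le> kolmogorov_dist (empirical_cdf X (A n)) (mcdf \<mu>)" for n
        by (rule order_trans[OF abs_ge_zero kolmogorov_dist_empirical_upper[where x = 0]])
           (use assms in \<open>auto simp: CDFs_def\<close>)
      ultimately have "eventually (\<lambda>n. norm (kolmogorov_dist (empirical_cdf X (A n)) (mcdf \<mu>) - 0) < r) sequentially"
        using \<open>r > 0\<close> by (auto elim!: eventually_mono)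
      then show "\<exists>no. \<forall>n\<ge>no. norm (kolmogorov_dist (empirical_cdf X (A n)) (mcdf \<mu>) - 0) < r"
        by (simp add: eventually_sequentially)
    qed
  qed
qed

section \<open>The strong law for frequencies\<close>

text \<open>Hoeffding's inequality, normalised by \<open>n\<close> instead of the number of summands so that the bound is the
  \<open>n\<close>-th term of a geometric series for arbitrarily small index sets \<open>A\<close>.\<close>

lemma (in prob_space) count_tail_bound:
  fixes X :: "'i \<Rightarrow> 'a \<Rightarrow> 'b::topological_space"
  assumes indep: "indep_vars (\<lambda>_. borel) X A" and A: "finite A" "card A \<le> n"
    and B: "B \<in> sets borel" and d: "0 < d"
  shows "prob {\<omega> \<in> space M. d * real n \<le> \<bar>real (card {i \<in> A. X i \<omega> \<in> B})
            - (\<Sum>i\<in>A. prob (X i -` B \<inter> space M))\<bar>} \<le> 2 * exp (- 2 * d\<^sup>2) ^ n"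
proof (cases "A = {}")
  case True
  then show ?thesis using d
    by (cases "n = 0") (auto simp: mult_le_0_iff prob_space)
next
  case False
  have X [measurable]: "random_variable borel (X i)" if "i \<in> A" for i
    using indep that by (auto simp: indep_vars_def)
  define Y where "Y = (\<lambda>i \<omega>. indicator B (X i \<omega>) :: real)"
  interpret Y: Hoeffding_ineq M A Y "\<lambda>_. 0" "\<lambda>_. 1" "\<Sum>i\<in>A. expectation (Y i)"
  proof unfold_locales
    show "indep_vars (\<lambda>_. borel) Y A"
      unfolding Y_def by (rule indep_vars_compose2[OF indep]) (use B in simp)
    show "AE \<omega> in M. Y i \<omega> \<in> {0..1}" for i by (simp add: Y_def indicator_def)
  qed (use A in auto)
  have mean: "expectation (Y i) = prob (X i -` B \<inter> space M)" if "i \<in> A" for i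
  proof -
    have "X i -` B \<inter> space M \<in> events" using X[OF that] B by (rule measurable_sets)
    moreover have "expectation (Y i) = expectation (indicator (X i -` B \<inter> space M))"
      by (intro Bochner_Integration.integral_cong) (auto simp: Y_def indicator_def)
    ultimately show ?thesis by simp
  qed
  have count: "real (card {i \<in> A. X i \<omega> \<in> B}) = (\<Sum>i\<in>A. Y i \<omega>)" for \<omega>
    using A by (simp add: Y_def indicator_def sum.If_cases Int_def)
  have "card A > 0" using False A by (simp add: card_gt_0_iff)
  have "prob {\<omega> \<in> space M. d * real n \<le> \<bar>real (card {i \<in> A. X i \<omega> \<in> B})
            - (\<Sum>i\<in>A. prob (X i -` B \<inter> space M))\<bar>}
      \<le> 2 * exp (- 2 * (d * real n)\<^sup>2 / (\<Sum>i\<in>A. (1 - 0)\<^sup>2))"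
    using Y.Hoeffding_ineq_abs_ge[of "d * real n"] d \<open>card A > 0\<close>
    by (simp add: count mean)
  also have "\<dots> \<le> 2 * exp (real n * (- 2 * d\<^sup>2))"
  proof -
    have "2 * d\<^sup>2 * real n * real (card A) \<le> 2 * d\<^sup>2 * real n * real n"
      using A by (intro mult_left_mono) auto
    then show ?thesis
      using \<open>card A > 0\<close> by (simp add: field_simps power2_eq_square)
  qed
  also have "\<dots> = 2 * exp (- 2 * d\<^sup>2) ^ n" by (simp only: exp_of_nat_mult)
  finally show ?thesis .
qed

text \<open>By the Borel--Cantelli lemma, as the tail bounds are summable. Varying index
  sets and laws make it applicable both to the contaminated sample and to selections from it.\<close>

lemma (in prob_space) count_strong_law:
  fixes X :: "nat \<Rightarrow> 'a \<Rightarrow> 'b::topological_space"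
  assumes indep: "\<And>n. n \<ge> 1 \<Longrightarrow> indep_vars (\<lambda>_. borel) X {1..n}"
    and A: "\<And>n. A n \<subseteq> {1..n}" and B: "B \<in> sets borel"
  shows "AE \<omega> in M. (\<lambda>n. (real (card {i \<in> A n. X i \<omega> \<in> B})
           - (\<Sum>i\<in>A n. prob (X i -` B \<inter> space M))) / real n) \<longlonglongrightarrow> 0"
proof -
  define D where "D = (\<lambda>n \<omega>. real (card {i \<in> A n. X i \<omega> \<in> B}) - (\<Sum>i\<in>A n. prob (X i -` B \<inter> space M)))"
  have fin: "finite (A n)" for n using A finite_subset by blast
  have cardA: "card (A n) \<le> n" for n using card_mono[OF _ A, of n] by simp
  have indepA: "indep_vars (\<lambda>_. borel) X (A n)" for n
    by (rule indep_vars_subset[OF indep[of "max 1 n"]]) (use A[of n] in auto)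
  have X [measurable]: "random_variable borel (X i)" if "i \<in> A n" for i n
    using indepA that by (auto simp: indep_vars_def)
  have D_meas [measurable]: "D n \<in> borel_measurable M" for n
  proof -
    have "(\<lambda>\<omega>. \<Sum>i\<in>A n. indicator B (X i \<omega>) :: real) \<in> borel_measurable M"
      by (intro borel_measurable_sum measurable_compose[OF X]) (use B in auto)
    also have "(\<lambda>\<omega>. \<Sum>i\<in>A n. indicator B (X i \<omega>) :: real) = (\<lambda>\<omega>. real (card {i \<in> A n. X i \<omega> \<in> B}))"
      using fin by (simp add: indicator_def sum.If_cases Int_def)
    finally show ?thesis unfolding D_def by measurable
  qed
  have dev: "AE \<omega> in M. eventually (\<lambda>n. \<bar>D n \<omega>\<bar> < d * real n) sequentially" if "d > 0" for d
  proof -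
    define E where "E = (\<lambda>n. {\<omega> \<in> space M. d * real n \<le> \<bar>D n \<omega>\<bar>})"
    have "exp (- 2 * d\<^sup>2) < 1" using that by simp
    then have geom: "summable (\<lambda>n. 2 * exp (- 2 * d\<^sup>2) ^ n)" by (intro summable_mult summable_geometric) simp
    have "prob (E n) \<le> 2 * exp (- 2 * d\<^sup>2) ^ n" for n
      unfolding E_def D_def by (rule count_tail_bound[OF indepA fin cardA B that])
    then have "summable (\<lambda>n. prob (E n))"
      by (intro summable_comparison_test'[OF geom, of 0]) simp
    then have "AE \<omega> in M. eventually (\<lambda>n. \<omega> \<in> space M - E n) sequentially"
      by (intro borel_cantelli_AE1) (auto simp: E_def less_top[symmetric])
    then show ?thesis by (rule eventually_mono) (auto simp: E_def not_le elim: eventually_mono)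
  qed
  have "AE \<omega> in M. \<forall>k. eventually (\<lambda>n. \<bar>D n \<omega>\<bar> < 1 / real (Suc k) * real n) sequentially"
    unfolding AE_all_countable by (intro allI dev) simp
  then have "AE \<omega> in M. (\<lambda>n. D n \<omega> / real n) \<longlonglongrightarrow> 0"
  proof eventually_elim
    case (elim \<omega>)
    show ?case
    proof (rule tendstoI)
      fix e :: real assume "e > 0"
      then obtain k where k: "1 / real (Suc k) < e" using nat_approx_posE by blast
      show "eventually (\<lambda>n. dist (D n \<omega> / real n) 0 < e) sequentially"
        using elim[rule_format, of k] eventually_gt_at_top[of 0]
      proof eventually_elim
        fix n :: nat assume n: "\<bar>D n \<omega>\<bar> < 1 / real (Suc k) * real n" "0 < n"
        have "\<bar>D n \<omega>\<bar> / real n < 1 / real (Suc k)" using n by (subst pos_divide_less_eq) auto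
        then show "dist (D n \<omega> / real n) 0 < e" using k by (simp add: dist_real_def)
      qed
    qed
  qed
  then show ?thesis by (simp add: D_def)
qed

text \<open>The version for relative frequencies: \<open>c\<close> is the asymptotic share of the subsample and \<open>p\<close> the
  average probability of \<open>B\<close> over it.\<close>

lemma (in prob_space) freq_strong_law:
  fixes X :: "nat \<Rightarrow> 'a \<Rightarrow> 'b::topological_space"
  assumes indep: "\<And>n. n \<ge> 1 \<Longrightarrow> indep_vars (\<lambda>_. borel) X {1..n}"
    and A: "\<And>n. A n \<subseteq> {1..n}" and B: "B \<in> sets borel"
    and card: "(\<lambda>n. real (card (A n)) / real n) \<longlonglongrightarrow> c" "0 < c"
    and mean: "(\<lambda>n. (\<Sum>i\<in>A n. prob (X i -` B \<inter> space M)) / real n) \<longlonglongrightarrow> c * p"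
  shows "AE \<omega> in M. (\<lambda>n. freq (\<lambda>i. X i \<omega>) (A n) B) \<longlonglongrightarrow> p"
proof -
  have "AE \<omega> in M. (\<lambda>n. (real (card {i \<in> A n. X i \<omega> \<in> B})
           - (\<Sum>i\<in>A n. prob (X i -` B \<inter> space M))) / real n) \<longlonglongrightarrow> 0"
    by (rule count_strong_law) fact+
  then show ?thesis
  proof eventually_elim
    case (elim \<omega>)
    let ?C = "\<lambda>n. real (card {i \<in> A n. X i \<omega> \<in> B})"
    from tendsto_add[OF elim mean] have "(\<lambda>n. ?C n / real n) \<longlonglongrightarrow> c * p"
      by (simp flip: add_divide_distrib)
    from tendsto_divide[OF this card(1)] card(2)
    have "(\<lambda>n. (?C n / real n) / (real (card (A n)) / real n)) \<longlonglongrightarrow> p" by simp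
    moreover have "eventually (\<lambda>n. (?C n / real n) / (real (card (A n)) / real n)
        = freq (\<lambda>i. X i \<omega>) (A n) B) sequentially"
      using eventually_gt_at_top[of 0] by eventually_elim (simp add: freq_def)
    ultimately show ?case by (rule Lim_transform_eventually)
  qed
qed

section \<open>Subsamples of a convergent sample\<close>

lemma freq_subset_le:
  assumes "A \<subseteq> N" "finite N"
  shows "real (card A) / real (card N) * freq X A B \<le> freq X N B"
proof (cases "card A = 0")
  case True
  then show ?thesis by (simp add: freq_nonneg)
next
  case False
  have "card {i \<in> A. X i \<in> B} \<le> card {i \<in> N. X i \<in> B}"
    using assms by (intro card_mono) auto
  then show ?thesis using False by (simp add: freq_def divide_right_mono)
qed

lemma freq_Compl:
  assumes "finite A" "A \<noteq> {}"
  shows "freq X A (- B) = 1 - freq X A B"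
proof -
  have "card {i \<in> A. X i \<in> B} + card {i \<in> A. X i \<in> - B} = card A"
    using assms by (subst card_Un_disjoint[symmetric]) (auto intro: arg_cong[where f = card])
  then have "real (card {i \<in> A. X i \<in> B}) + real (card {i \<in> A. X i \<in> - B}) = real (card A)"
    by (simp flip: of_nat_add)
  moreover have "real (card A) \<noteq> 0" using assms by simp
  ultimately show ?thesis by (simp add: freq_def field_simps)
qed

lemma freq_hbox:
  fixes X :: "nat \<Rightarrow> real ^ 'p"
  assumes "finite A" "a \<le> b"
  shows "freq X A (hbox a b) = (\<Sum>S\<in>UNIV. (-1) ^ card S * freq X A {..corner a b S})"
proof -
  have count: "real (card {i \<in> A. X i \<in> B}) = (\<Sum>i\<in>A. indicator B (X i))" for B :: "(real ^ 'p) set"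
    using assms by (simp add: indicator_def sum.If_cases Int_def)
  have "(\<Sum>i\<in>A. indicator (hbox a b) (X i) :: real)
      = (\<Sum>S\<in>UNIV. (-1) ^ card S * (\<Sum>i\<in>A. indicator {..corner a b S} (X i)))"
    by (subst indicator_hbox[OF assms(2)], subst sum.swap) (simp add: sum_distrib_left)
  moreover have "freq X A B = (\<Sum>i\<in>A. indicator B (X i)) / real (card A)" for B
    by (simp add: freq_def count)
  ultimately show ?thesis
    by (simp only: sum_divide_distrib[where A = UNIV] times_divide_eq_right)
qed

lemma tendsto_freq_dyadic_box:
  assumes "finite_measure \<mu>" "sets \<mu> = sets borel" and fin: "\<And>n. finite (A n)"
    and lim: "\<And>k z. (\<lambda>n. freq X (A n) {..dyadic_point k z}) \<longlonglongrightarrow> mcdf \<mu> (dyadic_point k z)"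
  shows "(\<lambda>n. freq X (A n) (dyadic_box k z)) \<longlonglongrightarrow> measure \<mu> (dyadic_box k z)"
proof -
  let ?a = "dyadic_point k (z - 1)" and ?b = "dyadic_point k z"
  have ab: "?a \<le> ?b" by (simp add: less_eq_vec_def dyadic_point_def divide_right_mono)
  have "corner ?a ?b S = dyadic_point k (\<chi> i. if i \<in> S then z $ i - 1 else z $ i)" for S
    by (simp add: corner_def dyadic_point_def vec_eq_iff)
  then have "(\<lambda>n. freq X (A n) {..corner ?a ?b S}) \<longlonglongrightarrow> mcdf \<mu> (corner ?a ?b S)" for S
    using lim by simp
  then show ?thesis
    unfolding dyadic_box_def measure_hbox[OF assms(1,2) ab] freq_hbox[OF fin ab]
    by (intro tendsto_sum tendsto_mult_left)
qed

text \<open>In every set the subsample has at most the observations of the full sample. On a dyadic box both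
  frequencies converge, because the frequency of a box is a signed sum of frequencies of orthants, and
  the inequality passes to the limit.\<close>

lemma dominated_by_subsample_limit:
  assumes \<mu>: "finite_measure \<mu>" "sets \<mu> = sets borel" and \<nu>: "prob_space \<nu>" "sets \<nu> = sets borel"
    and A: "\<And>n. A n \<subseteq> N n" and fin: "\<And>n. finite (N n)"
    and ratio: "(\<lambda>n. real (card (A n)) / real (card (N n))) \<longlonglongrightarrow> \<tau>"
    and N: "\<And>k z. (\<lambda>n. freq X (N n) {..dyadic_point k z}) \<longlonglongrightarrow> mcdf \<mu> (dyadic_point k z)"
    and K: "(\<lambda>n. kolmogorov_dist (empirical_cdf X (A n)) (mcdf \<nu>)) \<longlonglongrightarrow> 0"
    and B: "B \<in> sets borel"
  shows "\<tau> * measure \<nu> B \<le> measure \<mu> B"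
proof (rule measure_le_if_dyadic_boxes[OF \<mu>(1) _ \<mu>(2) \<nu>(2) _ _ B])
  interpret \<nu>: prob_space \<nu> by fact
  show "finite_measure \<nu>" by (rule \<nu>.finite_measure_axioms)
  show "0 \<le> \<tau>" by (rule LIMSEQ_le_const[OF ratio]) auto
  fix k z
  have cdf: "mcdf \<nu> \<in> CDFs" using \<nu> by (auto simp: CDFs_def)
  have finA: "finite (A n)" for n using A fin finite_subset by blast
  have "(\<lambda>n. freq X (A n) {..x}) \<longlonglongrightarrow> mcdf \<nu> x" for x
  proof (rule LIM_zero_cancel, rule Lim_null_comparison[OF _ K])
    show "eventually (\<lambda>n. norm (freq X (A n) {..x} - mcdf \<nu> x)
            \<le> kolmogorov_dist (empirical_cdf X (A n)) (mcdf \<nu>)) sequentially"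
      using kolmogorov_dist_empirical_upper[OF cdf] by (simp add: empirical_cdf_eq_freq)
  qed
  then have lim: "(\<lambda>n. freq X (A n) (dyadic_box k z)) \<longlonglongrightarrow> measure \<nu> (dyadic_box k z)"
    using \<nu> finA by (intro tendsto_freq_dyadic_box) (auto intro: \<nu>.finite_measure_axioms)
  show "\<tau> * measure \<nu> (dyadic_box k z) \<le> measure \<mu> (dyadic_box k z)"
    by (rule LIMSEQ_le[OF tendsto_mult[OF ratio lim] tendsto_freq_dyadic_box[OF \<mu> fin N]])
       (use freq_subset_le[OF A fin] in blast)
qed

text \<open>Since the subsample has a positive share of the full sample, a set that is rare in the full sample is
  rare in the subsample. The point \<open>y\<close> is so large that both the complement of \<open>{..y}\<close> and the orthant
  \<open>{..- y}\<close> are rare; it is taken from the integer grid, where the frequencies are known to converge.\<close>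

lemma subsample_tight:
  fixes X :: "nat \<Rightarrow> real ^ 'p"
  assumes \<mu>: "prob_space \<mu>" "sets \<mu> = sets borel"
    and A: "\<And>n. A n \<subseteq> N n" and fin: "\<And>n. finite (N n)"
    and ratio: "(\<lambda>n. real (card (A n)) / real (card (N n))) \<longlonglongrightarrow> \<tau>" "0 < \<tau>"
    and N: "\<And>z. (\<lambda>n. freq X (N n) {..dyadic_point 0 z}) \<longlonglongrightarrow> mcdf \<mu> (dyadic_point 0 z)"
  obtains y where "eventually (\<lambda>n. 1 / 2 < empirical_cdf X (A n) y - empirical_cdf X (A n) (- y)) sequentially"
proof -
  interpret prob_space \<mu> by fact
  define y where "y = (\<lambda>c. dyadic_point 0 (\<chi> i. int c) :: real ^ 'p)"
  have y: "y c $ i = real c" for c i by (simp add: y_def dyadic_point_def)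
  have my: "- y c = dyadic_point 0 (\<chi> i. - int c)" for c
    by (simp add: y_def dyadic_point_def vec_eq_iff)
  have meas: "{..x} \<in> sets \<mu>" for x using \<mu> by simp
  have space: "space \<mu> = UNIV" using sets_eq_imp_space_eq[OF \<mu>(2)] by simp
  have "(\<lambda>c. measure \<mu> {..y c}) \<longlonglongrightarrow> measure \<mu> (\<Union>c. {..y c})"
    by (rule finite_Lim_measure_incseq)
       (use meas in \<open>auto simp: incseq_def less_eq_vec_def y intro: order_trans\<close>)
  moreover have "(\<Union>c. {..y c}) = UNIV"
  proof (intro equalityI subsetI UNIV_I)
    fix x :: "real ^ 'p"
    obtain c where "norm x \<le> real c" using real_arch_simple by blast
    then have "x \<le> y c"
      by (auto simp: less_eq_vec_def y intro: order_trans[OF order_trans[OF abs_ge_self component_le_norm_cart]])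
    then show "x \<in> (\<Union>c. {..y c})" by auto
  qed
  ultimately have up: "(\<lambda>c. measure \<mu> {..y c}) \<longlonglongrightarrow> 1" using prob_space by (simp add: space)
  have "(\<lambda>c. measure \<mu> {..- y c}) \<longlonglongrightarrow> measure \<mu> (\<Inter>c. {..- y c})"
    by (rule finite_Lim_measure_decseq)
       (use meas in \<open>auto simp: decseq_def less_eq_vec_def y intro: order_trans\<close>)
  moreover have "(\<Inter>c. {..- y c}) = {}"
  proof (intro equalityI subsetI)
    fix x assume x: "x \<in> (\<Inter>c. {..- y c})"
    obtain c where c: "norm x < real c" using reals_Archimedean2 by blast
    have "x $ undefined \<le> - real c" using x by (auto simp: less_eq_vec_def y)
    then show "x \<in> {}" using component_le_norm_cart[of x undefined] c by linarith
  qed simp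
  ultimately have down: "(\<lambda>c. measure \<mu> {..- y c}) \<longlonglongrightarrow> 0" by simp
  \<comment> \<open>Mass below \<open>\<tau> / 8\<close> in the full sample is mass below \<open>1 / 4\<close> in a subsample of share above \<open>\<tau> / 2\<close>.\<close>
  have "eventually (\<lambda>c. 1 - \<tau> / 8 < measure \<mu> {..y c} \<and> measure \<mu> {..- y c} < \<tau> / 8) sequentially"
    using order_tendstoD(1)[OF up, of "1 - \<tau> / 8"] order_tendstoD(2)[OF down, of "\<tau> / 8"] ratio(2)
    by (intro eventually_conj) simp_all
  then obtain c where c: "1 - \<tau> / 8 < measure \<mu> {..y c}" "measure \<mu> {..- y c} < \<tau> / 8"
    by (auto simp: eventually_sequentially)
  define \<rho> where "\<rho> = (\<lambda>n. real (card (A n)) / real (card (N n)))"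
  have "eventually (\<lambda>n. \<tau> / 2 < \<rho> n) sequentially"
    using order_tendstoD(1)[OF ratio(1), of "\<tau> / 2"] ratio(2) unfolding \<rho>_def by simp
  moreover have "eventually (\<lambda>n. 1 - \<tau> / 8 < freq X (N n) {..y c}) sequentially"
    using order_tendstoD(1)[OF N[of "\<chi> i. int c"], of "1 - \<tau> / 8"] c(1) by (simp add: mcdf_def y_def)
  moreover have "eventually (\<lambda>n. freq X (N n) {..- y c} < \<tau> / 8) sequentially"
    using order_tendstoD(2)[OF N[of "\<chi> i. - int c"], of "\<tau> / 8"] c(2) by (simp add: mcdf_def my)
  ultimately have "eventually (\<lambda>n. 1 / 2 < empirical_cdf X (A n) (y c) - empirical_cdf X (A n) (- y c)) sequentially"
  proof eventually_elim
    fix n assume \<rho>: "\<tau> / 2 < \<rho> n"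
      and far: "1 - \<tau> / 8 < freq X (N n) {..y c}" "freq X (N n) {..- y c} < \<tau> / 8"
    have ne: "A n \<noteq> {}" "N n \<noteq> {}" "finite (A n)"
      using \<rho> ratio(2) A[of n] fin[of n] by (auto simp: \<rho>_def finite_subset)
    have small: "freq X (A n) B < 1 / 4" if "freq X (N n) B < \<tau> / 8" for B
    proof -
      have "\<tau> / 2 * freq X (A n) B \<le> \<rho> n * freq X (A n) B"
        using \<rho> by (intro mult_right_mono freq_nonneg) auto
      also have "\<dots> \<le> freq X (N n) B" unfolding \<rho>_def by (rule freq_subset_le[OF A fin])
      finally have "\<tau> / 2 * freq X (A n) B < \<tau> / 2 * (1 / 4)" using that by simp
      then show ?thesis using ratio(2) by (subst (asm) mult_less_cancel_left_pos) auto
    qed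
    have "freq X (A n) (- {..y c}) < 1 / 4"
      using far(1) freq_Compl[OF fin ne(2), of X "{..y c}"] by (intro small) linarith
    then show "1 / 2 < empirical_cdf X (A n) (y c) - empirical_cdf X (A n) (- y c)"
      using small[OF far(2)] freq_Compl[OF ne(3,1), of X "{..y c}"]
      unfolding empirical_cdf_eq_freq by linarith
  qed
  then show thesis by (rule that)
qed

section \<open>Consistency of the minimum distance estimator\<close>

text \<open>A deterministic statement on one path of observations: \<open>\<theta> n\<close> is a parameter that fits the
  subsample \<open>A n\<close> of \<open>N n\<close> ever better. If \<open>\<theta>\<close> stayed away from \<open>\<theta>0\<close> along a subsequence, a further
  subsequence would converge to a point of the extended closure other than \<open>\<theta>0\<close>. Outside \<open>\<Theta>\<close>
  this contradicts tightness, and inside \<open>\<Theta>\<close> the domination of \<open>\<tau> \<nu>\<close> by \<open>\<mu>\<close>.\<close>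

lemma minimum_distance_consistency:
  fixes \<Theta> :: "'q::euclidean_space set" and F :: "'q \<Rightarrow> real ^ 'p \<Rightarrow> real" and X :: "nat \<Rightarrow> real ^ 'p"
  assumes F: "\<And>\<theta>. \<theta> \<in> \<Theta> \<Longrightarrow> F \<theta> \<in> CDFs"
    and cont: "\<And>\<phi>. \<phi> \<in> \<Theta> \<Longrightarrow> ((\<lambda>\<theta>. kolmogorov_dist (F \<theta>) (F \<phi>)) \<longlongrightarrow> 0) (at \<phi> within \<Theta>)"
    and escape: "\<And>x b. b \<in> ext_closure \<Theta> - Some ` \<Theta> \<Longrightarrow> ((\<lambda>\<theta>. F \<theta> x - F \<theta> (- x)) \<longlongrightarrow> 0) (towards b \<Theta>)"
    and \<mu>: "prob_space \<mu>" "sets \<mu> = sets borel"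
    and undominated: "\<And>\<phi> \<nu>. \<phi> \<in> \<Theta> \<Longrightarrow> \<phi> \<noteq> \<theta>0 \<Longrightarrow> prob_space \<nu> \<Longrightarrow> sets \<nu> = sets borel \<Longrightarrow> mcdf \<nu> = F \<phi> \<Longrightarrow>
        \<exists>B\<in>sets borel. measure \<mu> B < \<tau> * measure \<nu> B"
    and A: "\<And>n. A n \<subseteq> N n" and fin: "\<And>n. finite (N n)"
    and ratio: "(\<lambda>n. real (card (A n)) / real (card (N n))) \<longlonglongrightarrow> \<tau>" "0 < \<tau>"
    and N: "\<And>k z. (\<lambda>n. freq X (N n) {..dyadic_point k z}) \<longlonglongrightarrow> mcdf \<mu> (dyadic_point k z)"
    and \<theta>: "eventually (\<lambda>n. \<theta> n \<in> \<Theta>) sequentially"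
    and K: "(\<lambda>n. kolmogorov_dist (empirical_cdf X (A n)) (F (\<theta> n))) \<longlonglongrightarrow> 0"
  shows "\<theta> \<longlonglongrightarrow> \<theta>0"
proof (rule ccontr)
  have no_escape: False
    if r: "strict_mono r" and b: "b \<in> ext_closure \<Theta> - Some ` \<Theta>"
      and lim: "filterlim (\<theta> \<circ> r) (towards b \<Theta>) sequentially" for r b
  proof -
    obtain y where y: "eventually (\<lambda>n. 1 / 2 < empirical_cdf X (A n) y - empirical_cdf X (A n) (- y)) sequentially"
      by (rule subsample_tight[OF \<mu> A fin ratio N])
    \<comment> \<open>Replacing the subsample by its fit costs at most \<open>1 / 8\<close> at each of the two points \<open>y\<close> and \<open>- y\<close>.\<close>
    have "eventually (\<lambda>n. kolmogorov_dist (empirical_cdf X (A n)) (F (\<theta> n)) < 1 / 8) sequentially"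
      using K by (rule order_tendstoD) simp
    with y \<theta> have "eventually (\<lambda>n. 1 / 4 < F (\<theta> n) y - F (\<theta> n) (- y)) sequentially"
    proof eventually_elim
      case (elim n)
      then show ?case
        using kolmogorov_dist_empirical_upper[OF F, of "\<theta> n" X "A n" y]
          kolmogorov_dist_empirical_upper[OF F, of "\<theta> n" X "A n" "- y"] by linarith
    qed
    then have "eventually (\<lambda>n. 1 / 4 < F (\<theta> (r n)) y - F (\<theta> (r n)) (- y)) sequentially"
      by (rule eventually_subseq[OF r])
    moreover have "(\<lambda>n. F (\<theta> (r n)) y - F (\<theta> (r n)) (- y)) \<longlonglongrightarrow> 0"
      using filterlim_compose[OF escape[OF b, of y] lim] by simp
    then have "eventually (\<lambda>n. F (\<theta> (r n)) y - F (\<theta> (r n)) (- y) < 1 / 4) sequentially"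
      by (rule order_tendstoD) simp
    ultimately have "eventually (\<lambda>n :: nat. False) sequentially" by eventually_elim simp
    then show False by simp
  qed
  have no_other_limit: False
    if r: "strict_mono r" and \<phi>: "\<phi> \<in> \<Theta>" "\<phi> \<noteq> \<theta>0" and lim: "(\<theta> \<circ> r) \<longlonglongrightarrow> \<phi>" for r \<phi>
  proof -
    let ?d = "\<lambda>n. kolmogorov_dist (F (\<theta> (r n))) (F \<phi>)" and ?E = "\<lambda>n. empirical_cdf X (A (r n))"
    have in\<Theta>: "eventually (\<lambda>n. \<theta> (r n) \<in> \<Theta>) sequentially" by (rule eventually_subseq[OF r \<theta>])
    have "continuous (at \<phi> within \<Theta>) (\<lambda>\<theta>. kolmogorov_dist (F \<theta>) (F \<phi>))"
      using cont[OF \<phi>(1)] by (simp add: continuous_within)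
    then have d: "?d \<longlonglongrightarrow> kolmogorov_dist (F \<phi>) (F \<phi>)"
      using in\<Theta> lim[unfolded o_def] by (rule continuous_within_tendsto_compose)
    have E: "(\<lambda>n. kolmogorov_dist (?E n) (F (\<theta> (r n)))) \<longlonglongrightarrow> 0"
      using LIMSEQ_subseq_LIMSEQ[OF K r] by (simp add: o_def)
    have sum: "(\<lambda>n. kolmogorov_dist (?E n) (F (\<theta> (r n))) + ?d n) \<longlonglongrightarrow> 0"
      using tendsto_add[OF E d] by simp
    obtain \<nu> where \<nu>: "prob_space \<nu>" "sets \<nu> = sets borel" "F \<phi> = mcdf \<nu>"
      using F[OF \<phi>(1)] by (auto simp: CDFs_def)
    have "(\<lambda>n. kolmogorov_dist (?E n) (mcdf \<nu>)) \<longlonglongrightarrow> 0"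
    proof (rule Lim_null_comparison[OF _ sum])
      show "eventually (\<lambda>n. norm (kolmogorov_dist (?E n) (mcdf \<nu>))
              \<le> kolmogorov_dist (?E n) (F (\<theta> (r n))) + ?d n) sequentially"
        using in\<Theta>
      proof eventually_elim
        case (elim n)
        then show ?case
          using kolmogorov_dist_triangle[of "?E n" "F (\<theta> (r n))" "F \<phi>"]
            kolmogorov_dist_nonneg[of "?E n" "F \<phi>"] CDFs_bounds[OF F] \<phi>(1)
          by (simp add: empirical_cdf_bounds \<nu>(3)[symmetric])
      qed
    qed
    moreover have "(\<lambda>n. real (card (A (r n))) / real (card (N (r n)))) \<longlonglongrightarrow> \<tau>"
      using LIMSEQ_subseq_LIMSEQ[OF ratio(1) r] by (simp add: o_def)
    moreover have "(\<lambda>n. freq X (N (r n)) {..dyadic_point k z}) \<longlonglongrightarrow> mcdf \<mu> (dyadic_point k z)" for k z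
      using LIMSEQ_subseq_LIMSEQ[OF N r] by (simp add: o_def)
    ultimately have "\<tau> * measure \<nu> B \<le> measure \<mu> B" if "B \<in> sets borel" for B
      using that \<mu> \<nu> A fin
      by (intro dominated_by_subsample_limit[where A = "\<lambda>n. A (r n)" and N = "\<lambda>n. N (r n)"])
         (auto intro: prob_space.finite_measure)
    then show False using undominated[OF \<phi> \<nu>(1,2) \<nu>(3)[symmetric]] by (auto simp: not_less[symmetric])
  qed
  assume "\<not> \<theta> \<longlonglongrightarrow> \<theta>0"
  then obtain e where e: "e > 0" "\<not> eventually (\<lambda>n. dist (\<theta> n) \<theta>0 < e) sequentially"
    by (auto simp: tendsto_iff)
  have "infinite {n. \<theta> n \<in> \<Theta> \<and> e \<le> dist (\<theta> n) \<theta>0}"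
  proof
    assume "finite {n. \<theta> n \<in> \<Theta> \<and> e \<le> dist (\<theta> n) \<theta>0}"
    then have "eventually (\<lambda>n. \<not> (\<theta> n \<in> \<Theta> \<and> e \<le> dist (\<theta> n) \<theta>0)) sequentially"
      by (simp add: cofinite_eq_sequentially[symmetric] eventually_cofinite)
    with \<theta> have "eventually (\<lambda>n. dist (\<theta> n) \<theta>0 < e) sequentially" by eventually_elim auto
    then show False using e(2) by contradiction
  qed
  then obtain r :: "nat \<Rightarrow> nat" where r: "strict_mono r" "\<And>n. \<theta> (r n) \<in> \<Theta>" "\<And>n. e \<le> dist (\<theta> (r n)) \<theta>0"
    using infinite_enumerate by blast
  show False
  proof (cases "\<exists>C. infinite {n. norm (\<theta> (r n)) \<le> C}")
    case True
    then obtain C s where s: "strict_mono (s :: nat \<Rightarrow> nat)" "\<And>n. norm (\<theta> (r (s n))) \<le> C"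
      using infinite_enumerate by blast
    then have "bounded (range (\<theta> \<circ> r \<circ> s))" by (auto simp: bounded_iff)
    then obtain b t where t: "strict_mono (t :: nat \<Rightarrow> nat)" "((\<theta> \<circ> r \<circ> s) \<circ> t) \<longlonglongrightarrow> b"
      using bounded_imp_convergent_subsequence by blast
    define u where "u = r \<circ> s \<circ> t"
    have u: "strict_mono u" "(\<theta> \<circ> u) \<longlonglongrightarrow> b" "\<And>n. \<theta> (u n) \<in> \<Theta>" "\<And>n. e \<le> dist (\<theta> (u n)) \<theta>0"
      using r s t by (auto simp: u_def o_assoc intro!: strict_mono_o)
    have "b \<in> closure \<Theta>" unfolding closure_sequential using u(2,3) by (auto intro!: exI[of _ "\<theta> \<circ> u"])
    have "e \<le> dist b \<theta>0"
      by (rule tendsto_lowerbound[OF tendsto_dist[OF u(2) tendsto_const]]) (use u(4) in auto)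
    then have "b \<noteq> \<theta>0" using e(1) by auto
    show False
    proof (cases "b \<in> \<Theta>")
      case True
      then show False using no_other_limit u \<open>b \<noteq> \<theta>0\<close> by blast
    next
      case False
      moreover have "filterlim (\<theta> \<circ> u) (at b within \<Theta>) sequentially"
        unfolding filterlim_at using u False by (auto intro!: always_eventually)
      ultimately show False
        using no_escape[of u "Some b"] u(1) \<open>b \<in> closure \<Theta>\<close>
        by (auto simp: ext_closure_def towards_def)
    qed
  next
    case False
    \<comment> \<open>No subsequence is bounded, so the norms tend to infinity without passing to a further subsequence.\<close>
    have large: "eventually (\<lambda>n. C < norm (\<theta> (r n))) sequentially" for C
      using False by (simp add: cofinite_eq_sequentially[symmetric] eventually_cofinite not_less)
    have "\<not> bounded \<Theta>"
    proof
      assume "bounded \<Theta>"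
      then obtain C where "\<And>x. x \<in> \<Theta> \<Longrightarrow> norm x \<le> C" by (auto simp: bounded_iff)
      then show False using eventually_happens[OF large[of C]] r(2) by (force simp: not_less[symmetric])
    qed
    moreover have "filterlim (\<theta> \<circ> r) at_infinity sequentially"
      by (subst filterlim_at_infinity[of 0]) (auto intro: eventually_mono[OF large] less_imp_le)
    then have "filterlim (\<theta> \<circ> r) (inf at_infinity (principal \<Theta>)) sequentially"
      using r(2) by (simp add: filterlim_inf filterlim_principal o_def)
    ultimately show False
      using no_escape[of r None] r(1) by (auto simp: ext_closure_def towards_def)
  qed
qed

theorem proposition5p1:
  fixes M :: "'w measure"
    and X :: "nat \<Rightarrow> 'w \<Rightarrow> real ^ 'p"
    and \<Theta> :: "(real ^ 'q) set"
    and F :: "real ^ 'q \<Rightarrow> real ^ 'p \<Rightarrow> real"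
    and G :: "real ^ 'p \<Rightarrow> real"
    and \<theta>0 :: "real ^ 'q"
    and \<epsilon> \<tau> :: real
    and l k m :: "nat \<Rightarrow> nat"
    and Astar :: "nat \<Rightarrow> 'w \<Rightarrow> nat set"
    and \<theta>hat :: "nat \<Rightarrow> 'w \<Rightarrow> real ^ 'q"
  assumes prob: "prob_space M"
    and F_cdf: "\<And>\<theta>. \<theta> \<in> \<Theta> \<Longrightarrow> F \<theta> \<in> CDFs"
    and G_cdf: "G \<in> CDFs"
    and \<theta>0: "\<theta>0 \<in> \<Theta>"
    and \<epsilon>: "0 \<le> \<epsilon>" "\<epsilon> \<le> 1 / 2"
    and l_mono: "mono_on {1..} l"
    and l_lim: "(\<lambda>n. real (l n) / real n) \<longlonglongrightarrow> 1 - \<epsilon>"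
    and k_mono: "strict_mono_on {1..} k"
    and k_pos: "\<And>j. j \<ge> 1 \<Longrightarrow> k j \<ge> 1"
    and good_sub: "\<And>n. n \<ge> 1 \<Longrightarrow> good_indices k l n \<subseteq> {1..n}"
    and indep: "\<And>n. n \<ge> 1 \<Longrightarrow> prob_space.indep_vars M (\<lambda>_. borel) X {1..n}"
    and X_good: "\<And>n i. n \<ge> 1 \<Longrightarrow> i \<in> good_indices k l n \<Longrightarrow>
                   mcdf (distr M borel (X i)) = F \<theta>0"
    and X_bad: "\<And>n i. n \<ge> 1 \<Longrightarrow> i \<in> {1..n} - good_indices k l n \<Longrightarrow>
                   mcdf (distr M borel (X i)) = G"
    and m_less: "\<And>n. n \<ge> 1 \<Longrightarrow> m n < n"
    and c1: "\<forall>\<^sub>F n in sequentially. m n \<le> card (good_indices k l n)"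
            "(\<lambda>n. real (m n) / real n) \<longlonglongrightarrow> \<tau>" "\<tau> \<in> {1 / 2..1 - \<epsilon>}"
    and c2: "\<forall>\<theta>1\<in>\<Theta>. \<forall>\<theta>2\<in>\<Theta>. F \<theta>1 = F \<theta>2 \<longrightarrow> \<theta>1 = \<theta>2"
    and c3: "\<forall>\<phi>\<in>\<Theta>. ((\<lambda>\<theta>. kolmogorov_dist (F \<theta>) (F \<phi>)) \<longlongrightarrow> 0) (at \<phi> within \<Theta>)"
    and c4: "\<forall>x. \<forall>b \<in> ext_closure \<Theta> - Some ` \<Theta>.
               ((\<lambda>\<theta>. F \<theta> x - F \<theta> (- x)) \<longlongrightarrow> 0) (towards b \<Theta>)"
    and c5: "\<forall>\<theta>\<in>\<Theta>. \<theta> \<noteq> \<theta>0 \<longrightarrow>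
               (\<lambda>x. ((1 - \<epsilon>) * F \<theta>0 x + \<epsilon> * G x - \<tau> * F \<theta> x) / (1 - \<tau>)) \<notin> CDFs"
    and c6: "AE \<omega> in M. \<forall>\<^sub>F n in sequentially. \<forall>A \<in> subsamples n (m n).
               \<exists>\<theta>. is_arg_min (\<lambda>\<theta>. kolmogorov_dist (empirical_cdf (\<lambda>i. X i \<omega>) A) (F \<theta>))
                     (\<lambda>\<theta>. \<theta> \<in> \<Theta>) \<theta>"
    and Astar: "\<And>n \<omega>. n \<ge> 1 \<Longrightarrow> \<omega> \<in> space M \<Longrightarrow>
               is_arg_min (min_dist \<Theta> F (\<lambda>i. X i \<omega>)) (\<lambda>A. A \<in> subsamples n (m n)) (Astar n \<omega>)"
    and \<theta>hat: "\<And>n \<omega>. n \<ge> 1 \<Longrightarrow> \<omega> \<in> space M \<Longrightarrow>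
               \<exists>\<theta>. is_arg_min (\<lambda>\<theta>. kolmogorov_dist (empirical_cdf (\<lambda>i. X i \<omega>) (Astar n \<omega>)) (F \<theta>))
                     (\<lambda>\<theta>. \<theta> \<in> \<Theta>) \<theta> \<Longrightarrow>
               is_arg_min (\<lambda>\<theta>. kolmogorov_dist (empirical_cdf (\<lambda>i. X i \<omega>) (Astar n \<omega>)) (F \<theta>))
                     (\<lambda>\<theta>. \<theta> \<in> \<Theta>) (\<theta>hat n \<omega>)"
  shows "(AE \<omega> in M. (\<lambda>n. \<theta>hat n \<omega>) \<longlonglongrightarrow> \<theta>0) \<and>
         (AE \<omega> in M. (\<lambda>n. kolmogorov_dist (F (\<theta>hat n \<omega>)) (F \<theta>0)) \<longlonglongrightarrow> 0)"
proof -
  interpret prob_space M by fact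
  let ?good = "good_indices k l"
  obtain P0 where P0: "prob_space P0" "sets P0 = sets borel" "F \<theta>0 = mcdf P0"
    using F_cdf[OF \<theta>0] by (auto simp: CDFs_def)
  obtain PG where PG: "prob_space PG" "sets PG = sets borel" "G = mcdf PG"
    using G_cdf by (auto simp: CDFs_def)
  interpret P0: prob_space P0 by fact
  interpret PG: prob_space PG by fact
  obtain \<mu> where \<mu>_fin: "finite_measure \<mu>" and "sets \<mu> = sets P0"
    and "\<And>B. B \<in> sets P0 \<Longrightarrow> measure \<mu> B = (1 - \<epsilon>) * measure P0 B + \<epsilon> * measure PG B"
    by (rule measure_linear_combination[OF P0.finite_measure_axioms PG.finite_measure_axioms, of "1 - \<epsilon>" \<epsilon>])
       (use P0 PG \<epsilon> in auto)
  then have \<mu>_sets: "sets \<mu> = sets borel"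
    and \<mu>: "\<And>B. B \<in> sets borel \<Longrightarrow> measure \<mu> B = (1 - \<epsilon>) * measure P0 B + \<epsilon> * measure PG B"
    using P0(2) by auto
  interpret \<mu>: finite_measure \<mu> by fact
  have "measure \<mu> (space \<mu>) = 1"
    using \<mu>[of UNIV] P0.prob_space PG.prob_space
      sets_eq_imp_space_eq[OF \<mu>_sets] sets_eq_imp_space_eq[OF P0(2)] sets_eq_imp_space_eq[OF PG(2)]
    by simp
  then have \<mu>_prob: "prob_space \<mu>" by (intro prob_spaceI) (simp add: \<mu>.emeasure_eq_measure)
  have \<tau>: "0 < \<tau>" "\<tau> \<le> 1 - \<epsilon>" using c1(3) by auto

  \<comment> \<open>Only \<open>\<theta>0\<close> can explain a fraction \<open>\<tau>\<close> of the limit law of the full sample.\<close>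
  have undominated: "\<exists>B\<in>sets borel. measure \<mu> B < \<tau> * measure \<nu> B"
    if \<phi>: "\<phi> \<in> \<Theta>" "\<phi> \<noteq> \<theta>0" and \<nu>: "prob_space \<nu>" "sets \<nu> = sets borel" "mcdf \<nu> = F \<phi>" for \<phi> \<nu>
  proof (rule ccontr)
    assume "\<not> (\<exists>B\<in>sets borel. measure \<mu> B < \<tau> * measure \<nu> B)"
    then have dom: "\<And>B. B \<in> sets borel \<Longrightarrow> \<tau> * measure \<nu> B \<le> measure \<mu> B" by (auto simp: not_less)
    have cdf: "mcdf \<mu> x = (1 - \<epsilon>) * F \<theta>0 x + \<epsilon> * G x" for x
      using \<mu>[of "{..x}"] by (simp add: mcdf_def P0(3) PG(3))
    show False
    proof (cases "\<tau> < 1")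
      case True
      have "(\<lambda>x. ((1 - \<epsilon>) * F \<theta>0 x + \<epsilon> * G x - \<tau> * F \<phi> x) / (1 - \<tau>)) \<in> CDFs"
        using dominated_difference_in_CDFs[OF \<mu>_prob \<mu>_sets \<nu>(1,2) True dom] by (simp add: cdf \<nu>(3))
      then show False using c5 \<phi> by blast
    next
      case False
      \<comment> \<open>With nothing left over in the limit, \<open>\<mu>\<close> is the law of \<open>F \<theta>0\<close> and dominates the probability measure \<open>\<nu>\<close>.\<close>
      then have "\<tau> = 1" "\<epsilon> = 0" using \<tau> \<epsilon> by auto
      then have "mcdf \<nu> = mcdf \<mu>"
        using dom by (intro prob_space_dominated_mcdf_eq[OF \<mu>_prob \<mu>_sets \<nu>(1,2)]) auto
      then have "F \<phi> = F \<theta>0" using \<nu>(3) cdf \<open>\<epsilon> = 0\<close> by (simp add: fun_eq_iff)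
      then show False using c2 \<phi> \<theta>0 by blast
    qed
  qed

  have X_rv: "random_variable borel (X i)" if "1 \<le> i" for i
    using indep[OF that] that by (auto simp: indep_vars_def)
  have prob_good: "prob (X i -` B \<inter> space M) = measure P0 B"
    if "1 \<le> n" "i \<in> ?good n" "B \<in> sets borel" for n i B
  proof -
    have i: "1 \<le> i" using good_sub that by force
    have "distr M borel (X i) = P0"
      using X_good[OF that(1,2)] P0(3)
      by (intro mcdf_eqD[OF prob_space_distr[OF X_rv[OF i]] _ P0(1,2)]) simp_all
    then show ?thesis using measure_distr[OF X_rv[OF i]] that by simp
  qed
  have prob_bad: "prob (X i -` B \<inter> space M) = measure PG B"
    if "1 \<le> n" "i \<in> {1..n} - ?good n" "B \<in> sets borel" for n i B
  proof -
    have i: "1 \<le> i" using that by auto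
    have "distr M borel (X i) = PG"
      using X_bad[OF that(1,2)] PG(3)
      by (intro mcdf_eqD[OF prob_space_distr[OF X_rv[OF i]] _ PG(1,2)]) simp_all
    then show ?thesis using measure_distr[OF X_rv[OF i]] that by simp
  qed
  have card_good: "card (?good n) = l n" for n
  proof -
    have "inj_on k {1..l n}"
      using strict_mono_on_imp_inj_on[OF k_mono] by (rule inj_on_subset) auto
    then show ?thesis by (simp add: good_indices_def card_image)
  qed

  have full_law: "AE \<omega> in M. (\<lambda>n. freq (\<lambda>i. X i \<omega>) {1..n} B) \<longlonglongrightarrow> measure \<mu> B"
    if B: "B \<in> sets borel" for B
  proof (rule freq_strong_law[OF indep _ B, where c = 1])
    have pos: "eventually (\<lambda>n. 1 \<le> n) sequentially" by (rule eventually_ge_at_top)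
    show "(\<lambda>n. real (card {1..n}) / real n) \<longlonglongrightarrow> 1"
      by (rule tendsto_eventually) (use pos in eventually_elim, simp)
    have "(\<lambda>n. real (l n) / real n * measure P0 B + (1 - real (l n) / real n) * measure PG B)
        \<longlonglongrightarrow> (1 - \<epsilon>) * measure P0 B + (1 - (1 - \<epsilon>)) * measure PG B"
      by (intro tendsto_intros l_lim)
    moreover have "eventually (\<lambda>n. real (l n) / real n * measure P0 B + (1 - real (l n) / real n) * measure PG B
       = (\<Sum>i\<in>{1..n}. prob (X i -` B \<inter> space M)) / real n) sequentially"
      using pos
    proof eventually_elim
      case (elim n)
      have sub: "?good n \<subseteq> {1..n}" using good_sub elim by simp
      have "(\<Sum>i\<in>{1..n}. prob (X i -` B \<inter> space M))
          = (\<Sum>i\<in>{1..n} - ?good n. prob (X i -` B \<inter> space M)) + (\<Sum>i\<in>?good n. prob (X i -` B \<inter> space M))"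
        using sub by (intro sum.subset_diff) auto
      also have "\<dots> = real (card ({1..n} - ?good n)) * measure PG B + real (l n) * measure P0 B"
        using prob_good[OF elim _ B] prob_bad[OF elim _ B] by (simp add: card_good)
      also have "real (card ({1..n} - ?good n)) = real n - real (l n)"
        using card_mono[OF _ sub] sub
        by (subst card_Diff_subset) (auto simp: card_good of_nat_diff finite_subset)
      finally show ?case using elim by (simp add: field_simps)
    qed
    ultimately show "(\<lambda>n. (\<Sum>i\<in>{1..n}. prob (X i -` B \<inter> space M)) / real n) \<longlonglongrightarrow> 1 * measure \<mu> B"
      by (simp add: \<mu>[OF B] Lim_transform_eventually)
  qed auto

  \<comment> \<open>The competitors \<open>A0 n\<close>: nonrandom sets of \<open>m n\<close> good indices.\<close>
  have "\<exists>A. A \<subseteq> {1..n} \<and> (1 \<le> n \<longrightarrow> m n \<le> card (?good n) \<longrightarrow> A \<subseteq> ?good n \<and> card A = m n)" for n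
  proof (cases "1 \<le> n \<and> m n \<le> card (?good n)")
    case True
    then obtain A where "A \<subseteq> ?good n" "card A = m n" using obtain_subset_with_card_n by metis
    then show ?thesis using good_sub[of n] True by (intro exI[of _ A]) auto
  qed auto
  then obtain A0 where A0: "\<And>n. A0 n \<subseteq> {1..n}"
    "\<And>n. 1 \<le> n \<Longrightarrow> m n \<le> card (?good n) \<Longrightarrow> A0 n \<subseteq> ?good n \<and> card (A0 n) = m n"
    by metis
  have A0_good: "eventually (\<lambda>n. 1 \<le> n \<and> A0 n \<subseteq> ?good n \<and> card (A0 n) = m n) sequentially"
    using c1(1) eventually_ge_at_top[of 1] by eventually_elim (use A0 in auto)
  have good_law: "AE \<omega> in M. (\<lambda>n. freq (\<lambda>i. X i \<omega>) (A0 n) B) \<longlonglongrightarrow> measure P0 B"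
    if B: "B \<in> sets borel" for B
  proof (rule freq_strong_law[OF indep A0(1) B _ \<tau>(1)])
    show "(\<lambda>n. real (card (A0 n)) / real n) \<longlonglongrightarrow> \<tau>"
      by (rule Lim_transform_eventually[OF c1(2)]) (use A0_good in eventually_elim, simp)
    show "(\<lambda>n. (\<Sum>i\<in>A0 n. prob (X i -` B \<inter> space M)) / real n) \<longlonglongrightarrow> \<tau> * measure P0 B"
    proof (rule Lim_transform_eventually[OF tendsto_mult_right[OF c1(2)]])
      show "eventually (\<lambda>n. real (m n) / real n * measure P0 B
          = (\<Sum>i\<in>A0 n. prob (X i -` B \<inter> space M)) / real n) sequentially"
        using A0_good
      proof eventually_elim
        case (elim n)
        then have "(\<Sum>i\<in>A0 n. prob (X i -` B \<inter> space M)) = (\<Sum>i\<in>A0 n. measure P0 B)"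
          using B by (intro sum.cong refl prob_good[of n]) auto
        then show ?case using elim by simp
      qed
    qed
  qed
  obtain \<B> where \<B>: "countable \<B>" "\<B> \<subseteq> sets borel"
    "\<And>X A. (\<And>n. finite (A n)) \<Longrightarrow> (\<And>B. B \<in> \<B> \<Longrightarrow> (\<lambda>n. freq X (A n) B) \<longlonglongrightarrow> measure P0 B) \<Longrightarrow>
       (\<lambda>n. kolmogorov_dist (empirical_cdf X (A n)) (mcdf P0)) \<longlonglongrightarrow> 0"
    using Glivenko_Cantelli_countable_reduction[OF P0(1,2)] by blast
  have fin_A0: "finite (A0 n)" for n using A0(1) finite_subset by blast
  have "AE \<omega> in M. \<forall>B\<in>\<B>. (\<lambda>n. freq (\<lambda>i. X i \<omega>) (A0 n) B) \<longlonglongrightarrow> measure P0 B"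
    using good_law \<B>(1,2) by (subst AE_ball_countable) auto
  moreover have "AE \<omega> in M. \<forall>j z. (\<lambda>n. freq (\<lambda>i. X i \<omega>) {1..n} {..dyadic_point j z})
      \<longlonglongrightarrow> mcdf \<mu> (dyadic_point j z)"
    using full_law by (simp add: AE_all_countable mcdf_def)
  ultimately have both: "AE \<omega> in M. (\<lambda>n. \<theta>hat n \<omega>) \<longlonglongrightarrow> \<theta>0 \<and>
      (\<lambda>n. kolmogorov_dist (F (\<theta>hat n \<omega>)) (F \<theta>0)) \<longlonglongrightarrow> 0"
    using c6 AE_space
  proof eventually_elim
    fix \<omega>
    assume good: "\<forall>B\<in>\<B>. (\<lambda>n. freq (\<lambda>i. X i \<omega>) (A0 n) B) \<longlonglongrightarrow> measure P0 B"
      and full: "\<forall>j z. (\<lambda>n. freq (\<lambda>i. X i \<omega>) {1..n} {..dyadic_point j z}) \<longlonglongrightarrow> mcdf \<mu> (dyadic_point j z)"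
      and ex: "\<forall>\<^sub>F n in sequentially. \<forall>A \<in> subsamples n (m n).
               \<exists>\<theta>. is_arg_min (\<lambda>\<theta>. kolmogorov_dist (empirical_cdf (\<lambda>i. X i \<omega>) A) (F \<theta>)) (\<lambda>\<theta>. \<theta> \<in> \<Theta>) \<theta>"
      and \<omega>: "\<omega> \<in> space M"
    define E where "E = empirical_cdf (\<lambda>i. X i \<omega>)"
    have A: "Astar n \<omega> \<subseteq> {1..n}" "card (Astar n \<omega>) = m n" if "1 \<le> n" for n
      using Astar[OF that \<omega>] by (auto simp: is_arg_min_def subsamples_def)
    have argmin: "eventually (\<lambda>n. is_arg_min (\<lambda>\<theta>. kolmogorov_dist (E (Astar n \<omega>)) (F \<theta>)) (\<lambda>\<theta>. \<theta> \<in> \<Theta>) (\<theta>hat n \<omega>)) sequentially"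
      using ex eventually_ge_at_top[of 1]
    proof eventually_elim
      case (elim n)
      then show ?case unfolding E_def using \<theta>hat[OF elim(2) \<omega>] A[OF elim(2)] by (auto simp: subsamples_def)
    qed
    then have in\<Theta>: "eventually (\<lambda>n. \<theta>hat n \<omega> \<in> \<Theta>) sequentially"
      by eventually_elim (simp add: is_arg_min_def)
    have nonneg: "0 \<le> kolmogorov_dist (E A) (F \<theta>)" if "\<theta> \<in> \<Theta>" for A \<theta>
      unfolding E_def by (intro kolmogorov_dist_nonneg empirical_cdf_bounds CDFs_bounds F_cdf that)
    have "(\<lambda>n. kolmogorov_dist (E (A0 n)) (F \<theta>0)) \<longlonglongrightarrow> 0"
      unfolding E_def P0(3) by (rule \<B>(3)) (use good fin_A0 in auto)
    moreover have "eventually (\<lambda>n. norm (kolmogorov_dist (E (Astar n \<omega>)) (F (\<theta>hat n \<omega>)))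
        \<le> kolmogorov_dist (E (A0 n)) (F \<theta>0)) sequentially"
      using argmin A0_good
    proof eventually_elim
      case (elim n)
      have "A0 n \<in> subsamples n (m n)" using elim A0(1) by (auto simp: subsamples_def)
      then have "min_dist \<Theta> F (\<lambda>i. X i \<omega>) (Astar n \<omega>) \<le> min_dist \<Theta> F (\<lambda>i. X i \<omega>) (A0 n)"
        using Astar[of n \<omega>] \<omega> elim(2) by (auto simp: is_arg_min_def not_less)
      moreover have "min_dist \<Theta> F (\<lambda>i. X i \<omega>) (A0 n) \<le> kolmogorov_dist (E (A0 n)) (F \<theta>0)"
        unfolding min_dist_def E_def[symmetric]
        by (rule cINF_lower[OF _ \<theta>0]) (use nonneg in \<open>auto intro!: bdd_belowI[of _ 0]\<close>)
      moreover have "kolmogorov_dist (E (Astar n \<omega>)) (F (\<theta>hat n \<omega>)) \<le> min_dist \<Theta> F (\<lambda>i. X i \<omega>) (Astar n \<omega>)"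
        unfolding min_dist_def E_def[symmetric]
        by (rule cINF_greatest) (use \<theta>0 elim(1) in \<open>auto simp: is_arg_min_def not_less\<close>)
      moreover have "0 \<le> kolmogorov_dist (E (Astar n \<omega>)) (F (\<theta>hat n \<omega>))"
        using elim(1) by (intro nonneg) (simp add: is_arg_min_def)
      ultimately show ?case by simp
    qed
    ultimately have K: "(\<lambda>n. kolmogorov_dist (E (Astar n \<omega>)) (F (\<theta>hat n \<omega>))) \<longlonglongrightarrow> 0"
      by (rule Lim_null_comparison[rotated])
    \<comment> \<open>The index is shifted because \<open>Astar 0\<close> is unspecified.\<close>
    have "(\<lambda>n. \<theta>hat (Suc n) \<omega>) \<longlonglongrightarrow> \<theta>0"
    proof (rule minimum_distance_consistency[where A = "\<lambda>n. Astar (Suc n) \<omega>" and N = "\<lambda>n. {1..Suc n}"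
          and X = "\<lambda>i. X i \<omega>"])
      show "((\<lambda>\<theta>. kolmogorov_dist (F \<theta>) (F \<phi>)) \<longlongrightarrow> 0) (at \<phi> within \<Theta>)" if "\<phi> \<in> \<Theta>" for \<phi>
        using c3 that by blast
      show "((\<lambda>\<theta>. F \<theta> x - F \<theta> (- x)) \<longlongrightarrow> 0) (towards b \<Theta>)" if "b \<in> ext_closure \<Theta> - Some ` \<Theta>" for x b
        using c4 that by blast
      show "(\<lambda>n. real (card (Astar (Suc n) \<omega>)) / real (card {1..Suc n})) \<longlonglongrightarrow> \<tau>"
        using LIMSEQ_Suc[OF c1(2)] A by simp
      show "(\<lambda>n. freq (\<lambda>i. X i \<omega>) {1..Suc n} {..dyadic_point j z}) \<longlonglongrightarrow> mcdf \<mu> (dyadic_point j z)" for j z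
        using LIMSEQ_Suc full by blast
      show "eventually (\<lambda>n. \<theta>hat (Suc n) \<omega> \<in> \<Theta>) sequentially"
        using in\<Theta> by (subst eventually_sequentially_Suc)
      show "(\<lambda>n. kolmogorov_dist (empirical_cdf (\<lambda>i. X i \<omega>) (Astar (Suc n) \<omega>)) (F (\<theta>hat (Suc n) \<omega>))) \<longlonglongrightarrow> 0"
        using LIMSEQ_Suc[OF K] by (simp add: E_def)
      show "Astar (Suc n) \<omega> \<subseteq> {1..Suc n}" for n using A by simp
    qed (use F_cdf \<mu>_prob \<mu>_sets undominated \<tau> in auto)
    then have lim: "(\<lambda>n. \<theta>hat n \<omega>) \<longlonglongrightarrow> \<theta>0" by (rule LIMSEQ_imp_Suc)
    have "continuous (at \<theta>0 within \<Theta>) (\<lambda>\<theta>. kolmogorov_dist (F \<theta>) (F \<theta>0))"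
      using c3 \<theta>0 by (simp add: continuous_within)
    then have "(\<lambda>n. kolmogorov_dist (F (\<theta>hat n \<omega>)) (F \<theta>0)) \<longlonglongrightarrow> kolmogorov_dist (F \<theta>0) (F \<theta>0)"
      using in\<Theta> lim by (rule continuous_within_tendsto_compose)
    with lim show "(\<lambda>n. \<theta>hat n \<omega>) \<longlonglongrightarrow> \<theta>0 \<and> (\<lambda>n. kolmogorov_dist (F (\<theta>hat n \<omega>)) (F \<theta>0)) \<longlonglongrightarrow> 0"
      by simp
  qed
  then show ?thesis by (auto elim: eventually_mono)
qed

end
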